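(* Let $k\in\{2,\dots,p\}$, $m\ge1$, and let $\omega_k$ satisfy $0<\omega_k\,\rho(\mathbb{D}_k^{-1}\mathbb{A}_k)\le1$. Then $$\big\|P_m(\omega_k\mathbb{D}_k^{-1}\mathbb{A}_k)\mathbf{g}_k\big\|_{\mathbb{A}_k,1}\le\|\mathbf{g}_k\|_{\mathbb{A}_k,1}\qquad\forall\,\mathbf{g}_k\in\mathbb{R}^{N_hN_k}.$$
   Context: Setting. $\Omega\subset\mathbb{R}^d$ is an axis-parallel open rectangular box, $\mathcal{T}_h$ a uniform Cartesian mesh of $\Omega$ by $N_h$ cubes (intervals/squares if $d=1,2$) of edge length $h$, and $\mathcal{F}_h$ the set of all interior and boundary faces. For $T\in\mathcal{T}_h$ with affine map $\boldsymbol{F}_T:[-1,1]^d\to T$ and $\boldsymbol\sigma\in\mathbb{N}^d$ let $\Psi_T^{\boldsymbol\sigma}(\boldsymbol{x})=\prod_{i=1}^d l_{\sigma_i}(\xi_i)$, $\boldsymbol\xi=\boldsymbol{F}_T^{-1}(\boldsymbol{x})$, where $l_n$ is the Legendre polynomial of degree $n$ with $l_n(1)=1$; $\Psi_T^{\boldsymbol\sigma}$ is extended by zero outside $T$. $U_k(\mathcal{T}_h)=\mathrm{span}\{\Psi_T^{\boldsymbol\sigma}:\|\boldsymbol\sigma\|_\infty\le k,\ T\in\mathcal{T}_h\}$; $N_k=(k+1)^d$. Levels are $k=1,\dots,p$. A function $v_k\in U_k(\mathcal{T}_h)$ is identified with its coefficient vector $\mathbf{v}_k\in\mathbb{R}^{N_hN_k}$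 in this basis. On an interior face $F=T_1\cap T_2$: $\{\!\{u\}\!\}=\frac12(u|_{T_1}+u|_{T_2})$, $[\![u]\!]=u|_{T_1}-u|_{T_2}$, and $\boldsymbol{n}$ is the unit normal from $T_1$ to $T_2$ (fixed orientation); on a boundary face $\{\!\{u\}\!\}=[\![u]\!]=u$ and $\boldsymbol{n}$ is the outward unit normal. For $u,v\in U_k(\mathcal{T}_h)$, $$\mathcal{A}_k(u,v)=\sum_{T}\int_T\nabla u\cdot\nabla v-\sum_{F\in\mathcal{F}_h}\int_F\{\!\{\nabla u\}\!\}\cdot\boldsymbol{n}\,[\![v]\!]-\sum_{F\in\mathcal{F}_h}\int_F\{\!\{\nabla v\}\!\}\cdot\boldsymbol{n}\,[\![u]\!]+\sum_{F\in\mathcal{F}_h}\frac{\alpha_0k^2}{h}\int_F[\![u]\!][\![v]\!],$$ where $\alpha_0>0$ is a fixed constant, large enough that $\mathcal{A}_k$ is coercive and continuous, uniformly in $h$ and $k$, in the norm $\|v\|_{1,k,h}^2=\sum_T\|\nabla v\|_{L^2(T)}^2+\frac{k^2}{h}\sum_F\|[\![v]\!]\|_{L^2(F)}^2$. The symmetric positive definite matrix $\mathbb{A}_k$ is defined by $\mathbf{v}_k^\top\mathbb{A}_k\mathbf{w}_k=\mathcal{A}_k(v_k,w_k)$; $\mathbb{D}_k$ is the diagonal part of $\mathbb{A}_k$; $\|\mathbf{v}\|_{\mathbb{A}_k,s}^2=\mathbf{v}^\top\mathbb{A}_k^s\mathbf{v}$; $\rho$ is the spectral radius. $P_m$ is the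 polynomial given by $P_0=1$, $P_1(x)=1-\frac43x$, $P_i(x)=\frac{4i-2}{2i+1}(1-2x)P_{i-1}(x)-\frac{2i-3}{2i+1}P_{i-2}(x)$ for $i\ge2$. *)

theory Defs
  imports
    "HOL-Analysis.Analysis"
    "Jordan_Normal_Form.Spectral_Radius"
    "Jordan_Normal_Form.Gauss_Jordan_Elimination"
begin

text \<open>
  Points of the domain have type \<^typ>\<open>real^'d\<close>; coefficient vectors and matrices are those of
  Jordan_Normal_Form. The latter keep the notation, so components and inner products of points
  are written \<open>vec_nth\<close> and \<open>inner\<close>.
\<close>

no_notation vec_nth (infixl \<open>$\<close> 90)
unbundle no inner_syntax

subsection \<open>Mesh\<close>

text \<open>\<open>extent M i\<close> is the number of cells in direction \<open>i\<close>.\<close>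

record ('d::finite) cart_mesh =
  corner :: "real^'d"
  edge :: real
  extent :: "'d \<Rightarrow> nat"

definition uniform_mesh_of :: "'d::finite cart_mesh \<Rightarrow> (real^'d) set \<Rightarrow> bool" where
  "uniform_mesh_of M \<Omega> \<longleftrightarrow> edge M > 0 \<and> (\<forall>i. extent M i > 0) \<and>
     \<Omega> = box (corner M) (\<chi> i. vec_nth (corner M) i + edge M * real (extent M i))"

definition cells :: "'d::finite cart_mesh \<Rightarrow> ('d \<Rightarrow> nat) set" where
  "cells M = {t. \<forall>i. t i < extent M i}"

definition cell :: "'d::finite cart_mesh \<Rightarrow> ('d \<Rightarrow> nat) \<Rightarrow> (real^'d) set" where
  "cell M t = cbox (\<chi> i. vec_nth (corner M) i + edge M * real (t i))
                   (\<chi> i. vec_nth (corner M) i + edge M * (real (t i) + 1))"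

text \<open>
  The pair \<open>(i, q)\<close> stands for the face orthogonal to the \<open>i\<close>-th axis between the cells
  \<open>q(i := q i - 1)\<close> and \<open>q\<close>; it is a boundary face if one of these is not in the mesh, that is,
  if \<open>q i = 0\<close> or \<open>q i = extent M i\<close>.
\<close>

definition faces :: "'d::finite cart_mesh \<Rightarrow> ('d \<times> ('d \<Rightarrow> nat)) set" where
  "faces M = {(i, q). q i \<le> extent M i \<and> (\<forall>j. j \<noteq> i \<longrightarrow> q j < extent M j)}"

definition face_level :: "'d::finite cart_mesh \<Rightarrow> 'd \<times> ('d \<Rightarrow> nat) \<Rightarrow> real" where
  "face_level M = (\<lambda>(i, q). vec_nth (corner M) i + edge M * real (q i))"

definition face_set :: "'d::finite cart_mesh \<Rightarrow> 'd \<times> ('d \<Rightarrow> nat) \<Rightarrow> (real^'d) set" where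
  "face_set M = (\<lambda>(i, q). {x. vec_nth x i = face_level M (i, q) \<and>
     (\<forall>j. j \<noteq> i \<longrightarrow> vec_nth (corner M) j + edge M * real (q j) \<le> vec_nth x j \<and>
                   vec_nth x j \<le> vec_nth (corner M) j + edge M * (real (q j) + 1))})"

text \<open>The \<open>(d - 1)\<close>-dimensional Lebesgue measure on the hyperplane \<open>x\<^sub>i = s\<close>, as a measure on the
  whole space (a unit point mass if \<open>d = 1\<close>).\<close>

definition hyperplane_measure :: "'d::finite \<Rightarrow> real \<Rightarrow> (real^'d) measure" where
  "hyperplane_measure i s =
     distr (\<Pi>\<^sub>M j\<in>UNIV - {i}. lborel) borel (\<lambda>y. \<chi> j. if j = i then s else y j)"

definition face_integral ::
  "'d::finite cart_mesh \<Rightarrow> 'd \<times> ('d \<Rightarrow> nat) \<Rightarrow> (real^'d \<Rightarrow> real) \<Rightarrow> real" where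
  "face_integral M F f =
     set_lebesgue_integral (hyperplane_measure (fst F) (face_level M F)) (face_set M F) f"

subsection \<open>Discontinuous finite element spaces\<close>

fun legendre :: "nat \<Rightarrow> real \<Rightarrow> real" where
  "legendre 0 x = 1"
| "legendre (Suc 0) x = x"
| "legendre (Suc (Suc n)) x =
     ((2 * real n + 3) * x * legendre (Suc n) x - (real n + 1) * legendre n x) / (real n + 2)"

text \<open>The reference map \<open>F\<^sub>T\<close> sends \<open>\<xi>\<close> to the midpoint of \<open>T\<close> plus \<open>h/2 \<xi>\<close>.\<close>

definition ref_coord :: "'d::finite cart_mesh \<Rightarrow> ('d \<Rightarrow> nat) \<Rightarrow> real^'d \<Rightarrow> 'd \<Rightarrow> real" where
  "ref_coord M t x i =
     (vec_nth x i - (vec_nth (corner M) i + edge M * (real (t i) + 1/2))) / (edge M / 2)"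

definition basis_fun ::
  "'d::finite cart_mesh \<Rightarrow> ('d \<Rightarrow> nat) \<times> ('d \<Rightarrow> nat) \<Rightarrow> real^'d \<Rightarrow> real" where
  "basis_fun M = (\<lambda>(t, \<sigma>) x.
     if x \<in> cell M t then (\<Prod>i\<in>UNIV. legendre (\<sigma> i) (ref_coord M t x i)) else 0)"

definition dofs :: "'d::finite cart_mesh \<Rightarrow> nat \<Rightarrow> (('d \<Rightarrow> nat) \<times> ('d \<Rightarrow> nat)) set" where
  "dofs M k = cells M \<times> {\<sigma>. \<forall>i. \<sigma> i \<le> k}"

definition dg_space :: "'d::finite cart_mesh \<Rightarrow> nat \<Rightarrow> (real^'d \<Rightarrow> real) set" where
  "dg_space M k = {u. \<exists>c. u = (\<lambda>x. \<Sum>b\<in>dofs M k. c b * basis_fun M b x)}"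

subsection \<open>Interior penalty form\<close>

text \<open>The values of \<open>grad u\<close> on cell boundaries are irrelevant: the boundaries are null sets, and traces
  are limits from the interior of a cell.\<close>

definition grad :: "(real^'d \<Rightarrow> real) \<Rightarrow> real^'d \<Rightarrow> real^'d::finite" where
  "grad u x = (\<chi> i. frechet_derivative u (at x) (axis i 1))"

definition cell_trace ::
  "'d::finite cart_mesh \<Rightarrow> ('d \<Rightarrow> nat) \<Rightarrow> (real^'d \<Rightarrow> 'b::t2_space) \<Rightarrow> real^'d \<Rightarrow> 'b" where
  "cell_trace M t w x = Lim (at x within interior (cell M t)) w"

text \<open>On an interior face \<open>(i, q)\<close>, \<open>T\<^sub>1\<close> is the cell \<open>q(i := q i - 1)\<close> and \<open>T\<^sub>2\<close> the cell \<open>q\<close>, so the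
  normal is the \<open>i\<close>-th unit vector. The products of jump, average and normal in the form do not
  depend on this choice.\<close>

definition face_avg ::
  "'d::finite cart_mesh \<Rightarrow> 'd \<times> ('d \<Rightarrow> nat) \<Rightarrow> (real^'d \<Rightarrow> 'b::real_normed_vector) \<Rightarrow> real^'d \<Rightarrow> 'b" where
  "face_avg M = (\<lambda>(i, q) w x.
     if q i = 0 then cell_trace M q w x
     else if q i = extent M i then cell_trace M (q(i := q i - 1)) w x
     else (1/2) *\<^sub>R (cell_trace M (q(i := q i - 1)) w x + cell_trace M q w x))"

definition face_jump ::
  "'d::finite cart_mesh \<Rightarrow> 'd \<times> ('d \<Rightarrow> nat) \<Rightarrow> (real^'d \<Rightarrow> real) \<Rightarrow> real^'d \<Rightarrow> real" where
  "face_jump M = (\<lambda>(i, q) w x.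
     if q i = 0 then cell_trace M q w x
     else if q i = extent M i then cell_trace M (q(i := q i - 1)) w x
     else cell_trace M (q(i := q i - 1)) w x - cell_trace M q w x)"

definition face_normal :: "'d \<times> ('d \<Rightarrow> nat) \<Rightarrow> real^'d::finite" where
  "face_normal = (\<lambda>(i, q). if q i = 0 then - axis i 1 else axis i 1)"

definition sip_form ::
  "real \<Rightarrow> 'd::finite cart_mesh \<Rightarrow> nat \<Rightarrow> (real^'d \<Rightarrow> real) \<Rightarrow> (real^'d \<Rightarrow> real) \<Rightarrow> real" where
  "sip_form \<alpha>\<^sub>0 M k u v =
     (\<Sum>t\<in>cells M. integral (cell M t) (\<lambda>x. inner (grad u x) (grad v x)))
   - (\<Sum>F\<in>faces M. face_integral M F
        (\<lambda>x. inner (face_avg M F (grad u) x) (face_normal F) * face_jump M F v x))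
   - (\<Sum>F\<in>faces M. face_integral M F
        (\<lambda>x. inner (face_avg M F (grad v) x) (face_normal F) * face_jump M F u x))
   + (\<Sum>F\<in>faces M. \<alpha>\<^sub>0 * (real k)\<^sup>2 / edge M *
        face_integral M F (\<lambda>x. face_jump M F u x * face_jump M F v x))"

definition dg_norm :: "'d::finite cart_mesh \<Rightarrow> nat \<Rightarrow> (real^'d \<Rightarrow> real) \<Rightarrow> real" where
  "dg_norm M k v = sqrt (
     (\<Sum>t\<in>cells M. integral (cell M t) (\<lambda>x. (norm (grad v x))\<^sup>2))
   + (real k)\<^sup>2 / edge M * (\<Sum>F\<in>faces M. face_integral M F (\<lambda>x. (face_jump M F v x)\<^sup>2)))"

definition uniformly_stable :: "real \<Rightarrow> (real^'d::finite) set \<Rightarrow> nat \<Rightarrow> bool" where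
  "uniformly_stable \<alpha>\<^sub>0 \<Omega> p \<longleftrightarrow>
     (\<exists>c > 0. \<exists>C > 0. \<forall>M k. uniform_mesh_of M \<Omega> \<longrightarrow> k \<in> {1..p} \<longrightarrow>
        (\<forall>v\<in>dg_space M k. sip_form \<alpha>\<^sub>0 M k v v \<ge> c * (dg_norm M k v)\<^sup>2) \<and>
        (\<forall>u\<in>dg_space M k. \<forall>v\<in>dg_space M k.
           \<bar>sip_form \<alpha>\<^sub>0 M k u v\<bar> \<le> C * dg_norm M k u * dg_norm M k v))"

subsection \<open>Coefficient vectors and matrices\<close>

definition ndofs :: "'d::finite cart_mesh \<Rightarrow> nat \<Rightarrow> nat" where
  "ndofs M k = card (cells M) * (k + 1) ^ CARD('d)"

text \<open>A numbering \<open>e\<close> of the basis identifies coefficient vectors with functions.\<close>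

definition dof_numbering ::
  "'d::finite cart_mesh \<Rightarrow> nat \<Rightarrow> (nat \<Rightarrow> ('d \<Rightarrow> nat) \<times> ('d \<Rightarrow> nat)) \<Rightarrow> bool" where
  "dof_numbering M k e \<longleftrightarrow> bij_betw e {..<ndofs M k} (dofs M k)"

definition fun_of_vec ::
  "'d::finite cart_mesh \<Rightarrow> nat \<Rightarrow> (nat \<Rightarrow> ('d \<Rightarrow> nat) \<times> ('d \<Rightarrow> nat)) \<Rightarrow> real Matrix.vec
     \<Rightarrow> real^'d \<Rightarrow> real" where
  "fun_of_vec M k e v x = (\<Sum>r<ndofs M k. v $ r * basis_fun M (e r) x)"

definition sip_matrix ::
  "real \<Rightarrow> 'd::finite cart_mesh \<Rightarrow> nat \<Rightarrow> (nat \<Rightarrow> ('d \<Rightarrow> nat) \<times> ('d \<Rightarrow> nat)) \<Rightarrow> real Matrix.mat" where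
  "sip_matrix \<alpha>\<^sub>0 M k e = (THE A. A \<in> carrier_mat (ndofs M k) (ndofs M k) \<and>
     (\<forall>v\<in>carrier_vec (ndofs M k). \<forall>w\<in>carrier_vec (ndofs M k).
        v \<bullet> (A *\<^sub>v w) = sip_form \<alpha>\<^sub>0 M k (fun_of_vec M k e v) (fun_of_vec M k e w)))"

definition diag_part :: "real Matrix.mat \<Rightarrow> real Matrix.mat" where
  "diag_part A = mat_diag (dim_row A) (\<lambda>i. A $$ (i, i))"

text \<open>The matrix \<open>D\<^sup>-\<^sup>1 A\<close>, where \<open>D\<close> is the diagonal part of \<open>A\<close>.\<close>

definition jacobi_matrix :: "real Matrix.mat \<Rightarrow> real Matrix.mat" where
  "jacobi_matrix A = the (mat_inverse (diag_part A)) * A"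

definition energy_norm :: "real Matrix.mat \<Rightarrow> nat \<Rightarrow> real Matrix.vec \<Rightarrow> real" where
  "energy_norm A s v = sqrt (v \<bullet> ((A ^\<^sub>m s) *\<^sub>v v))"

definition real_spectral_radius :: "real Matrix.mat \<Rightarrow> real" where
  "real_spectral_radius A = spectral_radius (map_mat complex_of_real A)"

fun smoother_poly :: "nat \<Rightarrow> real poly" where
  "smoother_poly 0 = 1"
| "smoother_poly (Suc 0) = [:1, - 4/3:]"
| "smoother_poly (Suc (Suc n)) = (let i = real (Suc (Suc n)) in
     Polynomial.smult ((4 * i - 2) / (2 * i + 1)) ([:1, -2:] * smoother_poly (Suc n))
     - Polynomial.smult ((2 * i - 3) / (2 * i + 1)) (smoother_poly n))"

definition poly_at_mat :: "real poly \<Rightarrow> real Matrix.mat \<Rightarrow> real Matrix.mat" where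
  "poly_at_mat q B = Matrix.mat (dim_row B) (dim_col B)
     (\<lambda>(r, c). \<Sum>i\<le>degree q. Polynomial.coeff q i * (B ^\<^sub>m i) $$ (r, c))"

end

theory Submission
  imports Defs
begin

text \<open>
  With \<open>1 - 2 x = cos \<theta>\<close> the polynomial \<open>(2 m + 1) P\<^sub>m\<close> is the Dirichlet kernel
  \<open>1 + 2 (cos \<theta> + \<dots> + cos (m \<theta>))\<close>, so it suffices that the matrices
  \<open>T\<^sub>j = cos (j \<theta>)\<close>, taken at \<open>X = \<omega> D\<^sup>-\<^sup>1 A\<close>, are contractions in the energy norm. As \<open>X\<close> is
  self-adjoint in the energy inner product, \<open>cos\<^sup>2 + sin\<^sup>2 = 1\<close> reduces this to \<open>X (1 - X) \<ge> 0\<close>,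
  that is, to \<open>\<omega> A \<le> D\<close>, which is what the bound on the spectral radius of \<open>D\<^sup>-\<^sup>1 A\<close> says.

  The properties of \<open>A\<close> that enter are symmetry, positive semidefiniteness (coercivity) and a
  positive diagonal: every basis function is a nonzero polynomial on each face of its cell, hence
  has a nonzero jump there. Since \<open>A\<close> is given by a description, the form must also be shown
  to be bilinear, which rests on the integrability of the traces.
\<close>

section \<open>Positive semidefinite matrices and spectral radii\<close>

text \<open>The inequality lives in two inner products. The matrix \<open>D^-1 A\<close> is
  self-adjoint for \<open>A\<close> and for \<open>D\<close>, and the substitution
  \<open>z = D^-1 A y\<close> turns the claim \<open>X (1 - X) \<ge> 0\<close> about the first into
  the Rayleigh quotient bound \<open>z . A z \<le> \<rho> (z . D z)\<close> about the second. The
  spectral radius, defined by complex eigenvalues, enters that bound only through the growth of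
  powers: a radius below one keeps them bounded. This requires a strict inequality, so the bound is
  first shown for every constant above the radius and then passes to the limit; the borderline case
  \<open>\<omega> \<rho> = 1\<close> is thereby included.

  The second obstacle is that a discrete function is badly behaved exactly where the form samples
  it: closed cells overlap on faces, so point values there mix the neighbours. Everything is
  therefore phrased through a globally smooth function that agrees with the given one in the open
  cell; traces and cell integrals see only that function.\<close>

lemma mat_entry_eq_scalar_prod:
  fixes C :: "real Matrix.mat"
  assumes "C \<in> carrier_mat n n" "r < n" "s < n"
  shows "C $$ (r, s) = unit_vec n r \<bullet> (C *\<^sub>v unit_vec n s)"
  using assms by (simp add: scalar_prod_left_unit[where n = n] scalar_prod_right_unit[where n = n])

lemma pow_mat_Suc_mult_vec:
  fixes X :: "real Matrix.mat"
  assumes X: "X \<in> carrier_mat n n" and y: "y \<in> carrier_vec n"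
  shows "(X ^\<^sub>m Suc i) *\<^sub>v y = X *\<^sub>v ((X ^\<^sub>m i) *\<^sub>v y)"
proof -
  have "X ^\<^sub>m Suc i = X * X ^\<^sub>m i"
    using X by (induction i) (auto simp: assoc_mult_mat[where n\<^sub>1=n and n\<^sub>2=n and n\<^sub>3=n and n\<^sub>4=n])
  then show ?thesis
    using X y by (simp add: assoc_mult_mat_vec[where n\<^sub>1=n and n\<^sub>2=n and n\<^sub>3=n] del: pow_mat.simps)
qed

text \<open>Instantiated both with the stiffness matrix and with its diagonal part. Symmetry is
  stated through the bilinear form because that is how the stiffness matrix is given.\<close>

locale psd_matrix =
  fixes n :: nat and A :: "real Matrix.mat"
  assumes carrier [simp]: "A \<in> carrier_mat n n"
    and form_commute: "x \<in> carrier_vec n \<Longrightarrow> y \<in> carrier_vec n \<Longrightarrow> x \<bullet> (A *\<^sub>v y) = y \<bullet> (A *\<^sub>v x)"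
    and form_nonneg: "x \<in> carrier_vec n \<Longrightarrow> 0 \<le> x \<bullet> (A *\<^sub>v x)"
begin

abbreviation form :: "real Matrix.vec \<Rightarrow> real Matrix.vec \<Rightarrow> real" where
  "form x y \<equiv> x \<bullet> (A *\<^sub>v y)"

lemma mult_vec_closed [simp]: "x \<in> carrier_vec n \<Longrightarrow> A *\<^sub>v x \<in> carrier_vec n"
  using carrier by (rule mult_mat_vec_carrier)

lemma form_add_left:
  "x \<in> carrier_vec n \<Longrightarrow> y \<in> carrier_vec n \<Longrightarrow> z \<in> carrier_vec n \<Longrightarrow> form (x + y) z = form x z + form y z"
  by (rule add_scalar_prod_distrib[where n = n]) auto

lemma form_add_right:
  "x \<in> carrier_vec n \<Longrightarrow> y \<in> carrier_vec n \<Longrightarrow> z \<in> carrier_vec n \<Longrightarrow> form z (x + y) = form z x + form z y"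
  using form_add_left[of x y z] by (simp add: form_commute)

lemma form_smult_left:
  "x \<in> carrier_vec n \<Longrightarrow> z \<in> carrier_vec n \<Longrightarrow> form (c \<cdot>\<^sub>v x) z = c * form x z"
  by (rule smult_scalar_prod_distrib[where n = n]) auto

lemma form_smult_right:
  "x \<in> carrier_vec n \<Longrightarrow> z \<in> carrier_vec n \<Longrightarrow> form z (c \<cdot>\<^sub>v x) = c * form z x"
  using form_smult_left[of x z c] by (simp add: form_commute)

text \<open>The form may be degenerate, so the usual minimisation over \<open>t\<close> is
  complemented by the case \<open>form y y = 0\<close>, where an affine function of \<open>t\<close>
  that stays nonnegative must be constant.\<close>

lemma Cauchy_Schwarz:
  assumes x: "x \<in> carrier_vec n" and y: "y \<in> carrier_vec n"
  shows "(form x y)\<^sup>2 \<le> form x x * form y y"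
proof -
  have quad: "0 \<le> form x x + 2 * t * form x y + t\<^sup>2 * form y y" for t
  proof -
    have "0 \<le> form (x + t \<cdot>\<^sub>v y) (x + t \<cdot>\<^sub>v y)"
      by (rule form_nonneg) (use x y in auto)
    also have "\<dots> = form x x + 2 * t * form x y + t\<^sup>2 * form y y"
      using x y form_commute[OF y x]
      by (simp add: form_add_left form_add_right form_smult_left form_smult_right
          power2_eq_square algebra_simps del: mult_add_distrib_mat_vec)
    finally show ?thesis .
  qed
  show ?thesis
  proof (cases "form y y = 0")
    case True
    have "form x y = 0"
    proof (rule ccontr)
      assume "form x y \<noteq> 0"
      \<comment> \<open>At this \<open>t\<close> the affine function takes the value -1.\<close>
      then show False
        using quad[of "- (form x x + 1) / (2 * form x y)"] True by (simp add: field_simps)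
    qed
    with True show ?thesis by simp
  next
    case False
    then have pos: "0 < form y y" using form_nonneg[OF y] by linarith
    have "0 \<le> form x x - (form x y)\<^sup>2 / form y y"
      using quad[of "- form x y / form y y"] pos by (simp add: field_simps power2_eq_square)
    then show ?thesis using pos by (simp add: field_simps)
  qed
qed

lemma triangle_ineq:
  assumes x: "x \<in> carrier_vec n" and y: "y \<in> carrier_vec n"
  shows "sqrt (form (x + y) (x + y)) \<le> sqrt (form x x) + sqrt (form y y)"
proof -
  have "form x y \<le> sqrt (form x x) * sqrt (form y y)"
    using Cauchy_Schwarz[OF x y] by (metis real_le_rsqrt real_sqrt_mult)
  moreover have "form (x + y) (x + y) = form x x + 2 * form x y + form y y"
    using x y form_commute[OF y x] by (simp add: form_add_left form_add_right)
  ultimately have "form (x + y) (x + y) \<le> (sqrt (form x x) + sqrt (form y y))\<^sup>2"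
    using form_nonneg[OF x] form_nonneg[OF y] by (simp add: power2_sum algebra_simps)
  then show ?thesis
    using form_nonneg[OF x] form_nonneg[OF y] by (intro real_le_lsqrt) auto
qed

end

text \<open>Log-convexity makes the ratios of consecutive terms nondecreasing. If the first ratio
  exceeded one, the sequence would grow geometrically and could not stay bounded.\<close>

lemma log_convex_bounded_imp_le:
  fixes a :: "nat \<Rightarrow> real"
  assumes nonneg: "\<And>k. 0 \<le> a k" and conv: "\<And>k. (a (Suc k))\<^sup>2 \<le> a k * a (Suc (Suc k))"
    and bounded: "\<And>k. a k \<le> c"
  shows "a 1 \<le> a 0"
proof (rule ccontr)
  assume "\<not> a 1 \<le> a 0"
  then have lt: "a 0 < a 1" by simp
  then have pos1: "0 < a 1" using nonneg[of 0] by linarith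
  have pos0: "0 < a 0"
  proof (rule ccontr)
    assume "\<not> 0 < a 0"
    then have "a 0 = 0" using nonneg[of 0] by linarith
    then show False using conv[of 0] pos1 by simp
  qed
  define r where "r = a 1 / a 0"
  have r: "1 < r" using lt pos0 by (simp add: r_def)
  have step: "0 < a k \<and> r * a k \<le> a (Suc k)" for k
  proof (induction k)
    case 0
    then show ?case using pos0 by (simp add: r_def)
  next
    case (Suc k)
    have pos: "0 < a (Suc k)" using Suc r mult_pos_pos[of r "a k"] by linarith
    have "a k * (r * a (Suc k)) = (r * a k) * a (Suc k)" by simp
    also have "\<dots> \<le> a (Suc k) * a (Suc k)" using Suc pos by (intro mult_right_mono) auto
    also have "\<dots> \<le> a k * a (Suc (Suc k))" using conv[of k] by (simp add: power2_eq_square)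
    finally show ?case using pos Suc by simp
  qed
  have growth: "r ^ k * a 0 \<le> a k" for k
  proof (induction k)
    case (Suc k)
    have "r ^ Suc k * a 0 = r * (r ^ k * a 0)" by simp
    also have "\<dots> \<le> r * a k" using Suc r by (intro mult_left_mono) auto
    finally show ?case using step[of k] by linarith
  qed simp
  obtain k where "c / a 0 < r ^ k" using real_arch_pow[OF r] by blast
  then show False using growth[of k] bounded[of k] pos0 by (simp add: field_simps)
qed

lemma real_spectral_radius_nonneg:
  assumes "B \<in> carrier_mat n n" "0 < n"
  shows "0 \<le> real_spectral_radius B"
  using spectral_radius_mem_max(1)[of "map_mat complex_of_real B" n] assms
  by (auto simp: real_spectral_radius_def)

text \<open>An eigenvector of \<open>c B\<close> for \<open>ev\<close> is one of \<open>B\<close>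
  for \<open>ev / c\<close>. The scaling serves to bring the radius below one.\<close>

lemma real_spectral_radius_smult_le:
  assumes B: "B \<in> carrier_mat n n" and n: "0 < n" and c: "0 < c"
  shows "real_spectral_radius (c \<cdot>\<^sub>m B) \<le> c * real_spectral_radius B"
proof -
  let ?B = "map_mat complex_of_real B"
  have eq: "map_mat complex_of_real (c \<cdot>\<^sub>m B) = complex_of_real c \<cdot>\<^sub>m ?B"
    by (rule eq_matI) auto
  obtain ev where ev: "ev \<in> spectrum (complex_of_real c \<cdot>\<^sub>m ?B)"
    and sr: "real_spectral_radius (c \<cdot>\<^sub>m B) = norm ev"
    using spectral_radius_mem_max(1)[of "complex_of_real c \<cdot>\<^sub>m ?B" n] B n
    by (auto simp: real_spectral_radius_def eq)
  from ev obtain v where v: "v \<in> carrier_vec n" "v \<noteq> 0\<^sub>v n"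
    and "(complex_of_real c \<cdot>\<^sub>m ?B) *\<^sub>v v = ev \<cdot>\<^sub>v v"
    using B by (auto simp: spectrum_def eigenvalue_def eigenvector_def)
  moreover have "(complex_of_real c \<cdot>\<^sub>m ?B) *\<^sub>v v = complex_of_real c \<cdot>\<^sub>v (?B *\<^sub>v v)"
    using B v by (intro eq_vecI) auto
  ultimately have cv: "complex_of_real c \<cdot>\<^sub>v (?B *\<^sub>v v) = ev \<cdot>\<^sub>v v" by simp
  have "?B *\<^sub>v v = (ev / complex_of_real c) \<cdot>\<^sub>v v"
  proof (rule eq_vecI)
    fix i assume i: "i < dim_vec ((ev / complex_of_real c) \<cdot>\<^sub>v v)"
    with cv B v have "complex_of_real c * (?B *\<^sub>v v) $ i = ev * v $ i"
      by (metis (no_types, lifting) carrier_matD(1) carrier_vecD dim_mult_mat_vec index_map_mat(2)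
          index_smult_vec)
    then show "(?B *\<^sub>v v) $ i = ((ev / complex_of_real c) \<cdot>\<^sub>v v) $ i"
      using i c by (simp add: field_simps)
  qed (use B v in auto)
  then have "ev / complex_of_real c \<in> spectrum ?B"
    using v B by (auto simp: spectrum_def eigenvalue_def eigenvector_def)
  then have "norm (ev / complex_of_real c) \<le> real_spectral_radius B"
    using spectral_radius_mem_max(2)[of ?B n] B n by (auto simp: real_spectral_radius_def)
  then show ?thesis using c by (simp add: sr norm_divide field_simps)
qed

text \<open>The bound is known for the complexified matrix, whose powers have the same entries as
  the real ones.\<close>

lemma real_spectral_radius_less_1_power_bounded:
  assumes B: "B \<in> carrier_mat n n" and "real_spectral_radius B < 1"
  obtains c where "\<And>k i j. i < n \<Longrightarrow> j < n \<Longrightarrow> \<bar>(B ^\<^sub>m k) $$ (i, j)\<bar> \<le> c"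
proof -
  let ?B = "map_mat complex_of_real B"
  obtain c where c: "\<And>k. norm_bound (?B ^\<^sub>m k) c"
    using spectral_radius_jnf_norm_bound_less_1_upper_triangular[of ?B n] assms
    by (auto simp: real_spectral_radius_def)
  have "\<bar>(B ^\<^sub>m k) $$ (i, j)\<bar> \<le> c" if "i < n" "j < n" for i j k
  proof -
    have "?B ^\<^sub>m k = map_mat complex_of_real (B ^\<^sub>m k)"
      using of_real_hom.mat_hom_pow[OF B] by metis
    moreover have "B ^\<^sub>m k \<in> carrier_mat n n" using B by (rule pow_carrier_mat)
    ultimately show ?thesis
      using c[of k] that unfolding norm_bound_def
      by (metis carrier_matD index_map_mat norm_of_real real_norm_def)
  qed
  then show thesis by (rule that)
qed

text \<open>A crude entrywise estimate; what matters is that the constant does not depend on the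
  exponent.\<close>

lemma (in psd_matrix) form_power_bounded:
  assumes N: "N \<in> carrier_mat n n" and sr: "real_spectral_radius N < 1" and z: "z \<in> carrier_vec n"
  obtains c where "\<And>k. form ((N ^\<^sub>m k) *\<^sub>v z) ((N ^\<^sub>m k) *\<^sub>v z) \<le> c"
proof -
  obtain c where c: "\<And>k i j. i < n \<Longrightarrow> j < n \<Longrightarrow> \<bar>(N ^\<^sub>m k) $$ (i, j)\<bar> \<le> c"
    using real_spectral_radius_less_1_power_bounded[OF N sr] by blast
  define K where "K = c * (\<Sum>j<n. \<bar>z $ j\<bar>)"
  have K: "\<bar>((N ^\<^sub>m k) *\<^sub>v z) $ i\<bar> \<le> K" if "i < n" for k i
  proof -
    have Nk: "N ^\<^sub>m k \<in> carrier_mat n n" using N by (rule pow_carrier_mat)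
    have "((N ^\<^sub>m k) *\<^sub>v z) $ i = (\<Sum>j<n. (N ^\<^sub>m k) $$ (i, j) * z $ j)"
      using carrier_matD[OF Nk] z that
      by (simp add: scalar_prod_def atLeast0LessThan del: pow_mat_dim)
    also have "\<bar>\<dots>\<bar> \<le> (\<Sum>j<n. c * \<bar>z $ j\<bar>)"
      using c[OF that]
      by (intro order.trans[OF sum_abs] sum_mono) (auto simp: abs_mult intro!: mult_right_mono)
    finally show ?thesis by (simp add: K_def sum_distrib_left)
  qed
  have "form ((N ^\<^sub>m k) *\<^sub>v z) ((N ^\<^sub>m k) *\<^sub>v z) \<le> (\<Sum>i<n. \<Sum>j<n. K * (\<bar>A $$ (i, j)\<bar> * K))" for k
  proof -
    define v where "v = (N ^\<^sub>m k) *\<^sub>v z"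
    have v: "v \<in> carrier_vec n" "\<And>i. i < n \<Longrightarrow> \<bar>v $ i\<bar> \<le> K"
      using K[of _ k] pow_carrier_mat[OF N, of k] z by (auto simp: v_def)
    have "form v v = (\<Sum>i<n. \<Sum>j<n. v $ i * (A $$ (i, j) * v $ j))"
      using v carrier_matD[OF carrier]
      by (simp add: scalar_prod_def atLeast0LessThan sum_distrib_left)
    also have "\<dots> \<le> (\<Sum>i<n. \<Sum>j<n. K * (\<bar>A $$ (i, j)\<bar> * K))"
    proof (intro sum_mono)
      fix i j assume "i \<in> {..<n}" "j \<in> {..<n}"
      then have "\<bar>v $ i\<bar> * (\<bar>A $$ (i, j)\<bar> * \<bar>v $ j\<bar>) \<le> K * (\<bar>A $$ (i, j)\<bar> * K)"
        using v(2)[of i] v(2)[of j] by (intro mult_mono) auto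
      then show "v $ i * (A $$ (i, j) * v $ j) \<le> K * (\<bar>A $$ (i, j)\<bar> * K)"
        by (metis abs_mult abs_le_D1)
    qed
    finally show ?thesis by (simp add: v_def)
  qed
  then show thesis by (rule that)
qed

text \<open>For a self-adjoint \<open>N\<close>, Cauchy-Schwarz makes the squared norms of \<open>N\<^sup>k z\<close> log-convex in \<open>k\<close>.
  Bounded powers then force them to be nonincreasing, so no diagonalisation is needed.\<close>

lemma (in psd_matrix) form_le_of_spectral_radius_less_1:
  assumes N: "N \<in> carrier_mat n n" and sr: "real_spectral_radius N < 1"
    and adj: "\<And>x y. x \<in> carrier_vec n \<Longrightarrow> y \<in> carrier_vec n \<Longrightarrow> form (N *\<^sub>v x) y = form x (N *\<^sub>v y)"
    and z: "z \<in> carrier_vec n"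
  shows "form z (N *\<^sub>v z) \<le> form z z"
proof -
  define v where "v k = (N ^\<^sub>m k) *\<^sub>v z" for k
  have Nk: "N ^\<^sub>m k \<in> carrier_mat n n" for k using N by (rule pow_carrier_mat)
  have v: "v k \<in> carrier_vec n" for k using Nk[of k] z by (simp add: v_def)
  have v_Suc: "v (Suc k) = N *\<^sub>v v k" for k
    unfolding v_def using N z by (rule pow_mat_Suc_mult_vec)
  obtain c where "\<And>k. form (v k) (v k) \<le> c"
    using form_power_bounded[OF N sr z] by (auto simp: v_def)
  moreover have "(form (v (Suc k)) (v (Suc k)))\<^sup>2 \<le> form (v k) (v k) * form (v (Suc (Suc k))) (v (Suc (Suc k)))"
    for k
    using Cauchy_Schwarz[OF v[of k] v[of "Suc (Suc k)"]] adj[OF v[of k] v[of "Suc k"]]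
    by (simp add: v_Suc)
  ultimately have "form (v 1) (v 1) \<le> form (v 0) (v 0)"
    by (intro log_convex_bounded_imp_le[where a = "\<lambda>k. form (v k) (v k)"])
       (auto intro: form_nonneg v)
  moreover have v0: "v 0 = z" using N z by (simp add: v_def)
  moreover have v1: "v 1 = N *\<^sub>v z" using N z by (simp add: v_def)
  ultimately have le: "form (N *\<^sub>v z) (N *\<^sub>v z) \<le> form z z" by simp
  have Nz: "N *\<^sub>v z \<in> carrier_vec n" using N z by simp
  \<comment> \<open>The bound on the norm of \<open>N z\<close> becomes one on the quadratic form of
    \<open>N\<close> by Cauchy-Schwarz once more.\<close>
  have "(form z (N *\<^sub>v z))\<^sup>2 \<le> form z z * form (N *\<^sub>v z) (N *\<^sub>v z)"
    using Cauchy_Schwarz[OF z Nz] .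
  also have "\<dots> \<le> form z z * form z z"
    using le form_nonneg[OF z] by (intro mult_left_mono)
  finally have "(form z (N *\<^sub>v z))\<^sup>2 \<le> (form z z)\<^sup>2" by (simp add: power2_eq_square)
  then show ?thesis using form_nonneg[OF z] by (rule power2_le_imp_le)
qed

section \<open>Polynomials of a self-adjoint matrix\<close>

lemma poly_at_mat_closed [simp]: "X \<in> carrier_mat n n \<Longrightarrow> poly_at_mat q X \<in> carrier_mat n n"
  by (auto simp: poly_at_mat_def)

text \<open>The summation bound \<open>N\<close> is free above the degree so that polynomials of
  different degrees can be expanded over one common range.\<close>

lemma poly_at_mat_mult_vec_index:
  assumes X: "X \<in> carrier_mat n n" and y: "y \<in> carrier_vec n" and N: "degree q \<le> N" and r: "r < n"
  shows "(poly_at_mat q X *\<^sub>v y) $ r = (\<Sum>i\<le>N. Polynomial.coeff q i * ((X ^\<^sub>m i) *\<^sub>v y) $ r)"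
proof -
  have Xi: "X ^\<^sub>m i \<in> carrier_mat n n" for i using X by (rule pow_carrier_mat)
  have "(poly_at_mat q X *\<^sub>v y) $ r
      = (\<Sum>s<n. (\<Sum>i\<le>degree q. Polynomial.coeff q i * (X ^\<^sub>m i) $$ (r, s)) * y $ s)"
    using X y r by (simp add: poly_at_mat_def scalar_prod_def atLeast0LessThan)
  also have "\<dots> = (\<Sum>i\<le>degree q. Polynomial.coeff q i * (\<Sum>s<n. (X ^\<^sub>m i) $$ (r, s) * y $ s))"
    by (simp add: sum_distrib_right sum_distrib_left mult.assoc) (rule sum.swap)
  also have "\<dots> = (\<Sum>i\<le>degree q. Polynomial.coeff q i * ((X ^\<^sub>m i) *\<^sub>v y) $ r)"
    using carrier_matD[OF Xi] y r
    by (simp add: scalar_prod_def atLeast0LessThan del: pow_mat_dim)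
  also have "\<dots> = (\<Sum>i\<le>N. Polynomial.coeff q i * ((X ^\<^sub>m i) *\<^sub>v y) $ r)"
    using N by (intro sum.mono_neutral_left) (auto simp: coeff_eq_0)
  finally show ?thesis .
qed

context
  fixes n :: nat and X :: "real Matrix.mat" and y :: "real Matrix.vec"
  assumes X: "X \<in> carrier_mat n n" and y: "y \<in> carrier_vec n"
begin

lemma poly_at_mat_mult_vec_closed [simp]: "poly_at_mat q X *\<^sub>v y \<in> carrier_vec n"
  using X y poly_at_mat_closed mult_mat_vec_carrier by blast

lemma poly_at_mat_add_vec:
  "poly_at_mat (p + q) X *\<^sub>v y = poly_at_mat p X *\<^sub>v y + poly_at_mat q X *\<^sub>v y"
proof (rule eq_vecI)
  let ?N = "max (degree p) (degree q)"
  fix r assume "r < dim_vec (poly_at_mat p X *\<^sub>v y + poly_at_mat q X *\<^sub>v y)"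
  then have r: "r < n" using carrier_matD[OF poly_at_mat_closed[OF X]] by simp
  show "(poly_at_mat (p + q) X *\<^sub>v y) $ r = (poly_at_mat p X *\<^sub>v y + poly_at_mat q X *\<^sub>v y) $ r"
    unfolding index_add_vec(1)[OF r[folded carrier_vecD[OF poly_at_mat_mult_vec_closed[of q]]]]
      poly_at_mat_mult_vec_index[OF X y degree_add_le_max r]
      poly_at_mat_mult_vec_index[OF X y max.cobounded1 r, of p "degree q"]
      poly_at_mat_mult_vec_index[OF X y max.cobounded2 r, of q "degree p"]
    by (simp add: distrib_right sum.distrib del: index_mult_mat_vec)
qed (use carrier_matD[OF poly_at_mat_closed[OF X]] in simp)

lemma poly_at_mat_smult_vec:
  "poly_at_mat (Polynomial.smult c q) X *\<^sub>v y = c \<cdot>\<^sub>v (poly_at_mat q X *\<^sub>v y)"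
proof (rule eq_vecI)
  fix r assume "r < dim_vec (c \<cdot>\<^sub>v (poly_at_mat q X *\<^sub>v y))"
  then have r: "r < n" using carrier_matD[OF poly_at_mat_closed[OF X]] by simp
  show "(poly_at_mat (Polynomial.smult c q) X *\<^sub>v y) $ r = (c \<cdot>\<^sub>v (poly_at_mat q X *\<^sub>v y)) $ r"
    unfolding index_smult_vec(1)[OF r[folded carrier_vecD[OF poly_at_mat_mult_vec_closed[of q]]]]
      poly_at_mat_mult_vec_index[OF X y degree_smult_le r]
      poly_at_mat_mult_vec_index[OF X y order.refl r, of q]
    by (simp add: sum_distrib_left mult.assoc del: index_mult_mat_vec)
qed (use carrier_matD[OF poly_at_mat_closed[OF X]] in simp)

text \<open>Horner step: the shifted coefficients pair with \<open>X^(i+1) y = X (X^i y)\<close>. It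
  reduces facts about evaluation to induction over \<open>pCons\<close>.\<close>

lemma poly_at_mat_pCons_vec:
  "poly_at_mat (pCons a q) X *\<^sub>v y = a \<cdot>\<^sub>v y + X *\<^sub>v (poly_at_mat q X *\<^sub>v y)"
proof (rule eq_vecI)
  fix r assume "r < dim_vec (a \<cdot>\<^sub>v y + X *\<^sub>v (poly_at_mat q X *\<^sub>v y))"
  then have r: "r < n" using X by simp
  note pow = pow_mat_Suc_mult_vec[OF X y]
  have expand: "(X *\<^sub>v w) $ r = (\<Sum>s<n. X $$ (r, s) * w $ s)" if "w \<in> carrier_vec n" for w
    using X that r by (simp add: scalar_prod_def atLeast0LessThan)
  have Xi: "(X ^\<^sub>m i) *\<^sub>v y \<in> carrier_vec n" for i
    using X y pow_carrier_mat mult_mat_vec_carrier by blast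
  have "(poly_at_mat (pCons a q) X *\<^sub>v y) $ r
      = (\<Sum>i\<le>Suc (degree q). Polynomial.coeff (pCons a q) i * ((X ^\<^sub>m i) *\<^sub>v y) $ r)"
    by (rule poly_at_mat_mult_vec_index[OF X y _ r]) (rule degree_pCons_le)
  also have "\<dots> = a * y $ r + (\<Sum>i\<le>degree q. Polynomial.coeff q i * (X *\<^sub>v ((X ^\<^sub>m i) *\<^sub>v y)) $ r)"
    using X y by (subst sum.atMost_Suc_shift)
      (simp add: pow del: pow_mat.simps(2) index_mult_mat_vec)
  also have "(\<Sum>i\<le>degree q. Polynomial.coeff q i * (X *\<^sub>v ((X ^\<^sub>m i) *\<^sub>v y)) $ r)
      = (\<Sum>s<n. X $$ (r, s) * (\<Sum>i\<le>degree q. Polynomial.coeff q i * ((X ^\<^sub>m i) *\<^sub>v y) $ s))"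
    unfolding expand[OF Xi] sum_distrib_left by (subst sum.swap) (simp add: algebra_simps)
  also have "\<dots> = (X *\<^sub>v (poly_at_mat q X *\<^sub>v y)) $ r"
    by (simp add: expand poly_at_mat_mult_vec_index[OF X y order.refl] del: index_mult_mat_vec)
  finally show "(poly_at_mat (pCons a q) X *\<^sub>v y) $ r = (a \<cdot>\<^sub>v y + X *\<^sub>v (poly_at_mat q X *\<^sub>v y)) $ r"
    using r X y by simp
qed (use X carrier_matD[OF poly_at_mat_closed[OF X]] in simp)

lemma poly_at_mat_0_vec: "poly_at_mat 0 X *\<^sub>v y = 0\<^sub>v n"
proof (rule eq_vecI)
  fix r assume "r < dim_vec (0\<^sub>v n :: real Matrix.vec)"
  then show "(poly_at_mat 0 X *\<^sub>v y) $ r = 0\<^sub>v n $ r"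
    using poly_at_mat_mult_vec_index[OF X y order.refl, of r 0] by simp
qed (use carrier_matD[OF poly_at_mat_closed[OF X]] in simp)

lemma poly_at_mat_1_vec: "poly_at_mat 1 X *\<^sub>v y = y"
  unfolding one_pCons poly_at_mat_pCons_vec poly_at_mat_0_vec using X y by (intro eq_vecI) auto

lemma poly_at_mat_X_vec: "poly_at_mat [:0, 1:] X *\<^sub>v y = X *\<^sub>v y"
  using X y poly_at_mat_1_vec
  by (simp add: poly_at_mat_pCons_vec[of 0 1] flip: one_pCons) (intro eq_vecI; auto)

end

text \<open>Together with additivity this lets identities between polynomials act as identities
  between operators, which is how the Chebyshev relations are transferred to
  \<open>X\<close>.\<close>

lemma poly_at_mat_mult_vec:
  assumes X: "X \<in> carrier_mat n n" and y: "y \<in> carrier_vec n"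
  shows "poly_at_mat (p * q) X *\<^sub>v y = poly_at_mat p X *\<^sub>v (poly_at_mat q X *\<^sub>v y)"
proof (induction p)
  case 0
  show ?case using X y by (simp add: poly_at_mat_0_vec[where n = n])
next
  case (pCons a p)
  show ?case
    using X y pCons(2)
    by (simp add: poly_at_mat_add_vec[where n = n] poly_at_mat_smult_vec[where n = n]
        poly_at_mat_pCons_vec[where n = n])
       (intro eq_vecI; auto)
qed

text \<open>Self-adjointness is relative to the form of \<open>A\<close>; the matrix
  \<open>X\<close> itself need not be symmetric, as \<open>D^-1 A\<close> in general is not.\<close>

locale psd_selfadjoint = psd_matrix +
  fixes X :: "real Matrix.mat"
  assumes op_carrier [simp]: "X \<in> carrier_mat n n"
    and op_adjoint: "x \<in> carrier_vec n \<Longrightarrow> y \<in> carrier_vec n \<Longrightarrow> form (X *\<^sub>v x) y = form x (X *\<^sub>v y)"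
begin

lemma op_closed [simp]: "x \<in> carrier_vec n \<Longrightarrow> X *\<^sub>v x \<in> carrier_vec n"
  using op_carrier by (rule mult_mat_vec_carrier)

lemma poly_closed [simp]: "x \<in> carrier_vec n \<Longrightarrow> poly_at_mat q X *\<^sub>v x \<in> carrier_vec n"
  using op_carrier by (rule poly_at_mat_mult_vec_closed)

lemma op_commutes_poly:
  assumes "y \<in> carrier_vec n"
  shows "X *\<^sub>v (poly_at_mat q X *\<^sub>v y) = poly_at_mat q X *\<^sub>v (X *\<^sub>v y)"
proof -
  show ?thesis
    using poly_at_mat_mult_vec[OF op_carrier assms, of "[:0, 1:]" q]
      poly_at_mat_mult_vec[OF op_carrier assms, of q "[:0, 1:]"] assms
    by (simp add: poly_at_mat_X_vec[OF op_carrier] mult.commute del: mult_pCons_left mult_pCons_right)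
qed

text \<open>The induction moves one factor \<open>X\<close> across at a time, so the hypothesis is
  applied to \<open>X y\<close>, and \<open>X\<close> is then commuted back past the
  polynomial.\<close>

lemma poly_adjoint:
  assumes x: "x \<in> carrier_vec n" and y: "y \<in> carrier_vec n"
  shows "form (poly_at_mat q X *\<^sub>v x) y = form x (poly_at_mat q X *\<^sub>v y)"
  using y
proof (induction q arbitrary: y)
  case 0
  have "0\<^sub>v n = 0 \<cdot>\<^sub>v x" using x by auto
  then show ?case using x 0
    by (simp add: poly_at_mat_0_vec[OF op_carrier] form_smult_left form_smult_right)
next
  case (pCons a q)
  have "form (X *\<^sub>v (poly_at_mat q X *\<^sub>v x)) y = form x (X *\<^sub>v (poly_at_mat q X *\<^sub>v y))"
  proof -
    have "form (X *\<^sub>v (poly_at_mat q X *\<^sub>v x)) y = form (poly_at_mat q X *\<^sub>v x) (X *\<^sub>v y)"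
      using x pCons by (simp add: op_adjoint)
    also have "\<dots> = form x (poly_at_mat q X *\<^sub>v (X *\<^sub>v y))"
      using pCons by simp
    finally show ?thesis using pCons by (simp add: op_commutes_poly)
  qed
  then show ?case
    using x pCons
    by (simp add: poly_at_mat_pCons_vec[OF op_carrier] form_add_left form_add_right form_smult_left
        form_smult_right)
qed

end

text \<open>With \<open>1 - 2 x = cos \<theta>\<close>, these are \<open>cos (n \<theta>)\<close> and \<open>sin (n \<theta>) / sin \<theta>\<close>.\<close>

fun cheb_cos :: "nat \<Rightarrow> real poly" and cheb_sin :: "nat \<Rightarrow> real poly" where
  "cheb_cos 0 = 1"
| "cheb_cos (Suc n) = [:1, -2:] * cheb_cos n - (1 - [:1, -2:]\<^sup>2) * cheb_sin n"
| "cheb_sin 0 = 0"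
| "cheb_sin (Suc n) = [:1, -2:] * cheb_sin n + cheb_cos n"

text \<open>The recursion multiplies \<open>c + d w\<close>, where \<open>w^2 = s^2 - 1\<close>, by
  \<open>s + w\<close>. The latter has norm \<open>s^2 - w^2 = 1\<close>, so the norm
  \<open>c^2 - w^2 d^2\<close> is preserved.\<close>

lemma cheb_pythagoras: "(cheb_cos n)\<^sup>2 + (1 - [:1, -2:]\<^sup>2) * (cheb_sin n)\<^sup>2 = 1"
proof (induction n)
  case (Suc n)
  have *: "(s * c - (1 - s\<^sup>2) * d)\<^sup>2 + (1 - s\<^sup>2) * (s * d + c)\<^sup>2 = c\<^sup>2 + (1 - s\<^sup>2) * d\<^sup>2"
    for s c d :: "real poly"
    by (simp add: algebra_simps power2_eq_square)
  show ?case using Suc unfolding cheb_cos.simps cheb_sin.simps * .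
qed simp

lemma cheb_cos_recurrence: "cheb_cos (Suc (Suc n)) = 2 * [:1, -2:] * cheb_cos (Suc n) - cheb_cos n"
proof -
  have "s * (s * c - (1 - s\<^sup>2) * d) - (1 - s\<^sup>2) * (s * d + c) = 2 * s * (s * c - (1 - s\<^sup>2) * d) - c"
    for s c d :: "real poly"
    by (simp add: algebra_simps power2_eq_square)
  then show ?thesis by (simp only: cheb_cos.simps cheb_sin.simps)
qed

text \<open>In the variable \<open>1 - 2 x\<close> this is the Chebyshev polynomial of the fourth
  kind, \<open>sin ((m + 1/2) \<theta>) / sin (\<theta>/2)\<close>.\<close>

fun cheb_dirichlet :: "nat \<Rightarrow> real poly" where
  "cheb_dirichlet 0 = 1"
| "cheb_dirichlet (Suc m) = cheb_dirichlet m + 2 * cheb_cos (Suc m)"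

text \<open>The kernels inherit the three-term recurrence of the cosines because their differences
  are twice those cosines; one initial case fixes the constant.\<close>

lemma cheb_dirichlet_recurrence:
  "cheb_dirichlet (Suc (Suc m)) = 2 * [:1, -2:] * cheb_dirichlet (Suc m) - cheb_dirichlet m"
proof (induction m)
  case 0
  show ?case by (simp add: numeral_poly one_pCons power2_eq_square)
next
  case (Suc m)
  have *: "w2 + 2 * c3 = 2 * s * w2 - w1"
    if "c3 = 2 * s * c2 - c1" "w2 = 2 * s * w1 - w0" "w2 = w1 + 2 * c2" "w1 = w0 + 2 * c1"
    for w0 w1 w2 c1 c2 c3 s :: "real poly"
  proof -
    have "2 * s * w1 = w2 + w0" using that(2) by simp
    then show ?thesis using that(1,3,4) by (simp add: algebra_simps)
  qed
  have "cheb_dirichlet (Suc (Suc (Suc m))) = cheb_dirichlet (Suc (Suc m)) + 2 * cheb_cos (Suc (Suc (Suc m)))"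
    by (rule cheb_dirichlet.simps)
  also have "\<dots> = 2 * [:1, -2:] * cheb_dirichlet (Suc (Suc m)) - cheb_dirichlet (Suc m)"
    by (rule *[OF cheb_cos_recurrence Suc]) (rule cheb_dirichlet.simps)+
  finally show ?case .
qed

text \<open>Multiplied by \<open>2 i + 1\<close>, the recursion of the smoother has the coefficients
  \<open>4 i - 2 = 2 (2 (i - 1) + 1)\<close> and \<open>2 i - 3 = 2 (i - 2) + 1\<close>. They
  contain the normalising factors of the two predecessors, and what remains is the recurrence of the
  kernel.\<close>

lemma smoother_poly_eq_dirichlet:
  "Polynomial.smult (2 * real m + 1) (smoother_poly m) = cheb_dirichlet m"
proof (induction m rule: smoother_poly.induct)
  case 1
  show ?case by simp
next
  case 2
  show ?case by (simp add: numeral_poly one_pCons power2_eq_square)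
next
  case (3 n)
  define i where "i = real (Suc (Suc n))"
  have "Polynomial.smult (2 * i + 1) (smoother_poly (Suc (Suc n)))
      = Polynomial.smult (4 * i - 2) ([:1, -2:] * smoother_poly (Suc n))
        - Polynomial.smult (2 * i - 3) (smoother_poly n)"
    by (simp add: i_def Let_def smult_diff_right del: mult_pCons_left)
  also have "\<dots> = 2 * [:1, -2:] * Polynomial.smult (2 * real (Suc n) + 1) (smoother_poly (Suc n))
      - Polynomial.smult (2 * real n + 1) (smoother_poly n)"
  proof -
    have "Polynomial.smult (2 * c) p = 2 * Polynomial.smult c p" for c and p :: "real poly"
      by (simp add: numeral_poly mult.commute)
    from this[of "2 * real (Suc n) + 1" "[:1, -2:] * smoother_poly (Suc n)"] show ?thesis
      by (simp add: i_def algebra_simps del: mult_pCons_left mult_pCons_right)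
  qed
  also have "\<dots> = cheb_dirichlet (Suc (Suc n))"
    unfolding 3(1)[OF refl] 3(2)[OF refl] cheb_dirichlet_recurrence ..
  finally show ?case by (simp only: i_def)
qed

context psd_selfadjoint
begin

text \<open>If \<open>T\<close> and \<open>U\<close> are the two Chebyshev polynomials evaluated at \<open>X\<close> and \<open>y = U g\<close>, then
  \<open>T\<^sup>2 + 4 X (1 - X) U\<^sup>2 = 1\<close> gives \<open>form (T g) (T g) = form g g - 4 form (X (1 - X) y) y\<close>.\<close>

lemma form_cheb_cos_le:
  assumes contr: "\<And>y. y \<in> carrier_vec n \<Longrightarrow> form (X *\<^sub>v y) (X *\<^sub>v y) \<le> form y (X *\<^sub>v y)"
    and g: "g \<in> carrier_vec n"
  shows "form (poly_at_mat (cheb_cos j) X *\<^sub>v g) (poly_at_mat (cheb_cos j) X *\<^sub>v g) \<le> form g g"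
proof -
  let ?T = "cheb_cos j" and ?U = "cheb_sin j" and ?q = "1 - [:1, -2:]\<^sup>2 :: real poly"
  define y where "y = poly_at_mat ?U X *\<^sub>v g"
  have y: "y \<in> carrier_vec n" using g by (simp add: y_def)
  have qy: "poly_at_mat ?q X *\<^sub>v y = 4 \<cdot>\<^sub>v (X *\<^sub>v y) + (-4) \<cdot>\<^sub>v (X *\<^sub>v (X *\<^sub>v y))"
  proof -
    have q: "?q = Polynomial.smult 4 [:0, 1:] + Polynomial.smult (-4) ([:0, 1:] * [:0, 1:])"
      by (simp add: power2_eq_square one_pCons)
    show ?thesis
      unfolding q poly_at_mat_add_vec[OF op_carrier y] poly_at_mat_smult_vec[OF op_carrier y]
        poly_at_mat_mult_vec[OF op_carrier y]
      using y by (simp only: poly_at_mat_X_vec[OF op_carrier] op_closed)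
  qed
  \<comment> \<open>The product is grouped as \<open>U (q U)\<close> so that adjointness can move
    the outer factor to the other side.\<close>
  have "form g g = form g (poly_at_mat (?T * ?T + ?U * (?q * ?U)) X *\<^sub>v g)"
    using cheb_pythagoras[of j] poly_at_mat_1_vec[OF op_carrier g]
    by (simp add: power2_eq_square algebra_simps)
  also have "\<dots> = form (poly_at_mat ?T X *\<^sub>v g) (poly_at_mat ?T X *\<^sub>v g)
      + form y (poly_at_mat ?q X *\<^sub>v y)"
    using g by (simp add: poly_at_mat_add_vec[OF op_carrier] poly_at_mat_mult_vec[OF op_carrier]
        form_add_right poly_adjoint y_def)
  also have "form y (poly_at_mat ?q X *\<^sub>v y) = 4 * (form y (X *\<^sub>v y) - form (X *\<^sub>v y) (X *\<^sub>v y))"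
    unfolding qy using y op_adjoint[OF y, of "X *\<^sub>v y"]
    by (simp add: form_add_right form_smult_right)
  finally show ?thesis using contr[OF y] by simp
qed

text \<open>By the triangle inequality: the kernel is a sum of \<open>2 m + 1\<close> contractions,
  counted with multiplicity.\<close>

lemma form_cheb_dirichlet_le:
  assumes contr: "\<And>y. y \<in> carrier_vec n \<Longrightarrow> form (X *\<^sub>v y) (X *\<^sub>v y) \<le> form y (X *\<^sub>v y)"
    and g: "g \<in> carrier_vec n"
  shows "sqrt (form (poly_at_mat (cheb_dirichlet m) X *\<^sub>v g) (poly_at_mat (cheb_dirichlet m) X *\<^sub>v g))
    \<le> (2 * real m + 1) * sqrt (form g g)"
proof (induction m)
  case 0
  show ?case using g by (simp add: poly_at_mat_1_vec[OF op_carrier])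
next
  case (Suc m)
  define u where "u = poly_at_mat (cheb_dirichlet m) X *\<^sub>v g"
  define v where "v = poly_at_mat (cheb_cos (Suc m)) X *\<^sub>v g"
  have uv: "u \<in> carrier_vec n" "v \<in> carrier_vec n" using g by (auto simp: u_def v_def)
  have "cheb_dirichlet (Suc m) = cheb_dirichlet m + Polynomial.smult 2 (cheb_cos (Suc m))"
    by (simp add: numeral_poly)
  then have eq: "poly_at_mat (cheb_dirichlet (Suc m)) X *\<^sub>v g = u + 2 \<cdot>\<^sub>v v"
    unfolding u_def v_def
    by (simp only: poly_at_mat_add_vec[OF op_carrier g] poly_at_mat_smult_vec[OF op_carrier g])
  have "sqrt (form (u + 2 \<cdot>\<^sub>v v) (u + 2 \<cdot>\<^sub>v v)) \<le> sqrt (form u u) + sqrt (form (2 \<cdot>\<^sub>v v) (2 \<cdot>\<^sub>v v))"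
    using uv by (intro triangle_ineq) auto
  moreover have "sqrt (form (2 \<cdot>\<^sub>v v) (2 \<cdot>\<^sub>v v)) = 2 * sqrt (form v v)"
    using uv by (simp add: form_smult_left form_smult_right real_sqrt_mult)
  moreover have "sqrt (form v v) \<le> sqrt (form g g)"
    using form_cheb_cos_le[OF contr g, of "Suc m"] by (simp add: v_def del: cheb_cos.simps)
  moreover have "sqrt (form u u) \<le> (2 * real m + 1) * sqrt (form g g)"
    using Suc by (simp only: u_def)
  moreover have "(2 * real (Suc m) + 1) * sqrt (form g g)
      = (2 * real m + 1) * sqrt (form g g) + 2 * sqrt (form g g)"
    by (simp add: distrib_right)
  ultimately show ?case unfolding eq by linarith
qed

lemma form_smoother_poly_le:
  assumes contr: "\<And>y. y \<in> carrier_vec n \<Longrightarrow> form (X *\<^sub>v y) (X *\<^sub>v y) \<le> form y (X *\<^sub>v y)"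
    and g: "g \<in> carrier_vec n"
  shows "sqrt (form (poly_at_mat (smoother_poly m) X *\<^sub>v g) (poly_at_mat (smoother_poly m) X *\<^sub>v g))
    \<le> sqrt (form g g)"
proof -
  let ?c = "2 * real m + 1"
  have "poly_at_mat (cheb_dirichlet m) X *\<^sub>v g = ?c \<cdot>\<^sub>v (poly_at_mat (smoother_poly m) X *\<^sub>v g)"
    using poly_at_mat_smult_vec[OF op_carrier g] by (metis smoother_poly_eq_dirichlet)
  moreover have "sqrt (form (?c \<cdot>\<^sub>v v) (?c \<cdot>\<^sub>v v)) = ?c * sqrt (form v v)"
    if "v \<in> carrier_vec n" for v
  proof -
    have "form (?c \<cdot>\<^sub>v v) (?c \<cdot>\<^sub>v v) = ?c\<^sup>2 * form v v"
      using that by (simp add: form_smult_left form_smult_right power2_eq_square)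
    then show ?thesis by (simp add: real_sqrt_mult)
  qed
  ultimately have "?c * sqrt (form (poly_at_mat (smoother_poly m) X *\<^sub>v g) (poly_at_mat (smoother_poly m) X *\<^sub>v g))
      \<le> ?c * sqrt (form g g)"
    using form_cheb_dirichlet_le[OF contr g, of m] g
    by (metis poly_closed)
  then show ?thesis by (subst (asm) mult_le_cancel_left_pos) auto
qed

end

section \<open>The Jacobi-preconditioned matrix in the energy norm\<close>

lemma mat_diag_mult_vec_index:
  "i < n \<Longrightarrow> v \<in> carrier_vec n \<Longrightarrow> (mat_diag n f *\<^sub>v v) $ i = f i * (v $ i :: real)"
  by (auto simp: mat_diag_def scalar_prod_def if_distrib[of "\<lambda>x. x * _"] cong: if_cong)

lemma psd_matrix_mat_diag:
  assumes "\<And>i. i < n \<Longrightarrow> 0 \<le> f i"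
  shows "psd_matrix n (mat_diag n f)"
proof
  have form: "x \<bullet> (mat_diag n f *\<^sub>v y) = (\<Sum>i<n. f i * (x $ i * y $ i))"
    if "x \<in> carrier_vec n" "y \<in> carrier_vec n" for x y
    using that carrier_matD[OF mat_diag_dim[of n f]]
    by (auto simp: scalar_prod_def[of x] atLeast0LessThan mat_diag_mult_vec_index
        simp del: index_mult_mat_vec intro!: sum.cong)
  show "x \<bullet> (mat_diag n f *\<^sub>v y) = y \<bullet> (mat_diag n f *\<^sub>v x)"
    if "x \<in> carrier_vec n" "y \<in> carrier_vec n" for x y
    using that by (simp add: form mult.commute)
  show "0 \<le> x \<bullet> (mat_diag n f *\<^sub>v x)" if "x \<in> carrier_vec n" for x
    using that assms by (auto simp: form intro!: sum_nonneg)
qed simp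

text \<open>\<open>jacobi_matrix\<close> takes the inverse out of an option, so its existence has to
  be established before anything can be said about the product.\<close>

lemma mat_inverse_mat_diag:
  assumes "\<And>i. i < n \<Longrightarrow> f i \<noteq> (0 :: real)"
  obtains E where "mat_inverse (mat_diag n f) = Some E" "E \<in> carrier_mat n n"
    "mat_diag n f * E = 1\<^sub>m n"
proof -
  have "mat_diag n (\<lambda>i. f i * (1 / f i)) = 1\<^sub>m n"
    using assms by (auto simp: mat_diag_def)
  then have "mat_diag n f \<in> Units (ring_mat TYPE(real) n ())"
    unfolding Units_def
    by (auto simp: ring_mat_simps mult.commute[of _ "f _"] simp del: times_divide_eq_right
        intro!: bexI[of _ "mat_diag n (\<lambda>i. 1 / f i)"])
  then obtain E where E: "mat_inverse (mat_diag n f) = Some E"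
    using mat_inverse(1)[OF mat_diag_dim, of n f "()"] by blast
  show thesis
    using that[OF E] mat_inverse(2)[OF mat_diag_dim E] by blast
qed

lemma (in psd_matrix) energy_norm_eq: "energy_norm A 1 v = sqrt (form v v)"
  using left_mult_one_mat[OF carrier] carrier_matD[OF carrier] by (simp add: energy_norm_def)

theorem (in psd_matrix) smoother_contracts_energy_norm:
  assumes n: "0 < n" and diag: "\<And>i. i < n \<Longrightarrow> 0 < A $$ (i, i)"
    and pos: "0 < \<omega> * real_spectral_radius (jacobi_matrix A)"
    and le1: "\<omega> * real_spectral_radius (jacobi_matrix A) \<le> 1"
    and g: "g \<in> carrier_vec n"
  shows "energy_norm A 1 (poly_at_mat (smoother_poly m) (\<omega> \<cdot>\<^sub>m jacobi_matrix A) *\<^sub>v g)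
    \<le> energy_norm A 1 g"
proof -
  let ?\<rho> = "real_spectral_radius (jacobi_matrix A)"
  define D where "D = diag_part A"
  define B where "B = jacobi_matrix A"
  have D_eq: "D = mat_diag n (\<lambda>i. A $$ (i, i))"
    using carrier_matD[OF carrier] by (simp add: D_def diag_part_def)
  interpret D: psd_matrix n D
    unfolding D_eq using diag by (intro psd_matrix_mat_diag) (auto intro: less_imp_le)
  obtain E where E: "mat_inverse D = Some E" "E \<in> carrier_mat n n" "D * E = 1\<^sub>m n"
    unfolding D_eq using mat_inverse_mat_diag[of n "\<lambda>i. A $$ (i, i)"] diag by (metis less_irrefl)
  have B_eq: "B = E * A" by (simp add: B_def jacobi_matrix_def E flip: D_def)
  have B [simp]: "B \<in> carrier_mat n n" using E by (simp add: B_eq)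
  have DB: "D *\<^sub>v (B *\<^sub>v x) = A *\<^sub>v x" if "x \<in> carrier_vec n" for x
  proof -
    have "D * B = A" using E left_mult_one_mat[OF carrier]
      by (simp add: B_eq flip: assoc_mult_mat[OF D.carrier E(2) carrier])
    then show ?thesis using that by (metis assoc_mult_mat_vec B D.carrier)
  qed
  have Bv [simp]: "B *\<^sub>v x \<in> carrier_vec n" if "x \<in> carrier_vec n" for x
    using B that by (rule mult_mat_vec_carrier)
  have smult_vec: "(c \<cdot>\<^sub>m B) *\<^sub>v x = c \<cdot>\<^sub>v (B *\<^sub>v x)" if "x \<in> carrier_vec n" for c x
    using that carrier_matD[OF B] by (intro eq_vecI) auto
  \<comment> \<open>Positivity of \<open>\<omega>\<close> is drawn from that of the product, given
    that a spectral radius is nonnegative.\<close>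
  have \<rho>: "0 \<le> ?\<rho>" using real_spectral_radius_nonneg[OF B n] by (simp add: B_def)
  have \<omega>: "0 < \<omega>" using pos \<rho> by (simp add: zero_less_mult_iff)
  \<comment> \<open>Boundedness of powers is available for a radius strictly below one, hence a
    constant \<open>\<mu>\<close> strictly above the radius. The scaled matrix \<open>N\<close> is
    self-adjoint for \<open>D\<close> because \<open>D B = A\<close> is symmetric.\<close>
  have le_\<mu>: "form z z \<le> \<mu> * D.form z z" if \<mu>: "?\<rho> < \<mu>" and z: "z \<in> carrier_vec n" for \<mu> z
  proof -
    have "0 < \<mu>" using \<mu> \<rho> by linarith
    define N where "N = (1 / \<mu>) \<cdot>\<^sub>m B"
    have "real_spectral_radius N < 1"
      using real_spectral_radius_smult_le[OF B n, of "1 / \<mu>"] \<open>0 < \<mu>\<close> \<mu>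
      by (simp add: N_def B_def divide_less_eq_1 order.strict_trans1)
    moreover have "D.form (N *\<^sub>v x) y = D.form x (N *\<^sub>v y)"
      if "x \<in> carrier_vec n" "y \<in> carrier_vec n" for x y
      using that D.form_commute[of "B *\<^sub>v x" y]
      by (simp add: N_def smult_vec D.form_smult_left D.form_smult_right DB form_commute)
    ultimately have "D.form z (N *\<^sub>v z) \<le> D.form z z"
      using z by (intro D.form_le_of_spectral_radius_less_1) (auto simp: N_def)
    then show ?thesis
      using z \<open>0 < \<mu>\<close> by (simp add: N_def smult_vec D.form_smult_right DB field_simps)
  qed
  have le_\<rho>: "form z z \<le> ?\<rho> * D.form z z" if z: "z \<in> carrier_vec n" for z
  proof (rule field_le_epsilon)
    fix \<epsilon> :: real assume "0 < \<epsilon>"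
    define d where "d = D.form z z"
    have d: "0 \<le> d" using D.form_nonneg[OF z] by (simp add: d_def)
    \<comment> \<open>The limit from above; the denominator is \<open>d + 1\<close> because
      \<open>d\<close> vanishes for \<open>z = 0\<close>.\<close>
    have "form z z \<le> (?\<rho> + \<epsilon> / (d + 1)) * d"
      unfolding d_def by (rule le_\<mu>) (use \<open>0 < \<epsilon>\<close> d z in \<open>auto simp: d_def\<close>)
    moreover have "\<epsilon> / (d + 1) * d \<le> \<epsilon>"
      using \<open>0 < \<epsilon>\<close> d by (simp add: field_simps)
    ultimately show "form z z \<le> ?\<rho> * D.form z z + \<epsilon>"
      by (simp add: d_def distrib_right)
  qed
  \<comment> \<open>Both sides of the adjointness equation equal \<open>\<omega>\<close> times the
    \<open>D\<close>-product of \<open>B x\<close> and \<open>B y\<close>.\<close>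
  interpret psd_selfadjoint n A "\<omega> \<cdot>\<^sub>m B"
  proof
    show "form ((\<omega> \<cdot>\<^sub>m B) *\<^sub>v x) y = form x ((\<omega> \<cdot>\<^sub>m B) *\<^sub>v y)"
      if "x \<in> carrier_vec n" "y \<in> carrier_vec n" for x y
      using that D.form_commute[of "B *\<^sub>v x" "B *\<^sub>v y"] form_commute[of x "B *\<^sub>v y"]
      by (simp add: smult_vec form_smult_left form_smult_right DB)
  qed simp
  have "form ((\<omega> \<cdot>\<^sub>m B) *\<^sub>v y) ((\<omega> \<cdot>\<^sub>m B) *\<^sub>v y) \<le> form y ((\<omega> \<cdot>\<^sub>m B) *\<^sub>v y)"
    if y: "y \<in> carrier_vec n" for y
  proof -
    \<comment> \<open>For this \<open>z\<close>, \<open>form y z\<close> is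
      \<open>D.form z z\<close>, so the contraction condition becomes a comparison of the two
      quadratic forms at \<open>z\<close>.\<close>
    define z where "z = B *\<^sub>v y"
    have z: "z \<in> carrier_vec n" using y by (simp add: z_def)
    have "\<omega> * form z z \<le> \<omega> * (?\<rho> * D.form z z)"
      using \<omega> le_\<rho>[OF z] by (intro mult_left_mono) auto
    also have "\<dots> = (\<omega> * ?\<rho>) * D.form z z" by simp
    also have "\<dots> \<le> 1 * D.form z z"
      using le1 D.form_nonneg[OF z] by (intro mult_right_mono)
    also have "1 * D.form z z = form y z"
      using y z form_commute[of y z] by (simp add: z_def DB)
    finally have "\<omega> * (\<omega> * form z z) \<le> \<omega> * form y z"
      using \<omega> by (intro mult_left_mono) auto
    then show ?thesis
      using y z by (simp add: smult_vec form_smult_left form_smult_right flip: z_def)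
  qed
  from form_smoother_poly_le[OF this g, of m] show ?thesis
    unfolding energy_norm_eq by (simp add: B_def)
qed

section \<open>Piecewise smooth functions on the mesh\<close>

text \<open>The derivative is represented by its gradient, and smoothness is asked on the whole
  space, so that \<open>U\<close> and \<open>U'\<close> supply the limits at the boundary of a
  cell.\<close>

definition C1_fun :: "('a::real_inner \<Rightarrow> real) \<Rightarrow> ('a \<Rightarrow> 'a) \<Rightarrow> bool" where
  "C1_fun U U' \<longleftrightarrow> (\<forall>x. (U has_derivative inner (U' x)) (at x)) \<and> continuous_on UNIV U'"

lemma C1_fun_continuous: "C1_fun U U' \<Longrightarrow> continuous_on UNIV U"
  by (meson C1_fun_def continuous_at_imp_continuous_on has_derivative_continuous)

lemma C1_fun_linear:
  assumes "C1_fun U U'" "C1_fun V V'"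
  shows "C1_fun (\<lambda>x. a * U x + b * V x) (\<lambda>x. a *\<^sub>R U' x + b *\<^sub>R V' x)"
proof -
  have "((\<lambda>x. a * U x + b * V x) has_derivative inner (a *\<^sub>R U' x + b *\<^sub>R V' x)) (at x)" for x
  proof -
    have "(U has_derivative inner (U' x)) (at x)" "(V has_derivative inner (V' x)) (at x)"
      using assms by (auto simp: C1_fun_def)
    note this[derivative_intros]
    show ?thesis
      by (rule derivative_eq_intros refl)+ (auto simp: inner_add_left)
  qed
  then show ?thesis
    using assms by (auto simp: C1_fun_def intro!: continuous_intros)
qed

lemma C1_fun_mult:
  assumes "C1_fun U U'" "C1_fun V V'"
  shows "C1_fun (\<lambda>x. U x * V x) (\<lambda>x. U x *\<^sub>R V' x + V x *\<^sub>R U' x)"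
proof -
  have "((\<lambda>x. U x * V x) has_derivative inner (U x *\<^sub>R V' x + V x *\<^sub>R U' x)) (at x)" for x
  proof -
    have "(U has_derivative inner (U' x)) (at x)" "(V has_derivative inner (V' x)) (at x)"
      using assms by (auto simp: C1_fun_def)
    note this[derivative_intros]
    show ?thesis
      by (rule derivative_eq_intros refl)+ (auto simp: inner_add_left algebra_simps)
  qed
  then show ?thesis
    using assms C1_fun_continuous[OF assms(1)] C1_fun_continuous[OF assms(2)]
    by (auto simp: C1_fun_def intro!: continuous_intros)
qed

lemma C1_fun_const: "C1_fun (\<lambda>x. c) (\<lambda>x. 0)"
proof -
  have "inner (0 :: 'a) = (\<lambda>h. 0)" by auto
  then show ?thesis by (simp add: C1_fun_def)
qed

lemma C1_fun_prod:
  assumes "finite I" "\<And>i. i \<in> I \<Longrightarrow> \<exists>U'. C1_fun (U i) U'"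
  shows "\<exists>U'. C1_fun (\<lambda>x. \<Prod>i\<in>I. U i x) U'"
  using assms
proof (induction I rule: finite_induct)
  case empty
  then show ?case using C1_fun_const by auto
next
  case (insert i I)
  then obtain V' W' where "C1_fun (U i) V'" "C1_fun (\<lambda>x. \<Prod>i\<in>I. U i x) W'" by blast
  from C1_fun_mult[OF this] insert show ?case by auto
qed

lemma legendre_is_poly: "\<exists>p. \<forall>x. legendre n x = poly p x"
proof (induction n rule: less_induct)
  case (less n)
  show ?case
  proof (cases "n < 2")
    case True
    have "\<forall>x. legendre 0 x = poly 1 x" "\<forall>x. legendre (Suc 0) x = poly [:0, 1:] x" by auto
    moreover have "n = 0 \<or> n = Suc 0" using True by auto
    ultimately show ?thesis by blast
  next
    case False
    then obtain m where n: "n = Suc (Suc m)" by (metis One_nat_def Suc_1 less_Suc_eq not0_implies_Suc less_2_cases_iff)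
    obtain p q where pq: "\<forall>x. legendre (Suc m) x = poly p x" "\<forall>x. legendre m x = poly q x"
      using less[of m] less[of "Suc m"] n by auto
    have "\<forall>x. legendre n x = poly (Polynomial.smult (1 / (real m + 2))
        (Polynomial.smult (2 * real m + 3) ([:0, 1:] * p) - Polynomial.smult (real m + 1) q)) x"
      by (auto simp: n pq mult.assoc)
    then show ?thesis by blast
  qed
qed

lemma continuous_on_legendre [continuous_intros]:
  "continuous_on S f \<Longrightarrow> continuous_on S (\<lambda>x. legendre n (f x))"
  using legendre_is_poly[of n] by (auto intro!: continuous_intros)

text \<open>End values of modulus one keep a basis function from vanishing on a face of its cell,
  where the normal coordinate sits at an end of the reference interval.\<close>

lemma legendre_at_ends: "legendre n 1 = 1" "legendre n (- 1) = (- 1) ^ n"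
proof (induction n rule: less_induct)
  case (less n)
  show "legendre n 1 = 1" "legendre n (- 1) = (- 1) ^ n"
    using less by (cases "(n, 0::real)" rule: legendre.cases; simp add: field_simps)+
qed

text \<open>A basis function without the cut-off to its cell, hence smooth everywhere.\<close>

definition cell_poly ::
  "'d::finite cart_mesh \<Rightarrow> ('d \<Rightarrow> nat) \<times> ('d \<Rightarrow> nat) \<Rightarrow> real^'d \<Rightarrow> real" where
  "cell_poly M = (\<lambda>(t, \<sigma>) x. \<Prod>i\<in>UNIV. legendre (\<sigma> i) (ref_coord M t x i))"

lemma C1_fun_cell_poly:
  assumes edge: "edge M > 0"
  shows "\<exists>U'. C1_fun (cell_poly M b) U'"
proof -
  obtain t \<sigma> where b: "b = (t, \<sigma>)" by force
  have "\<exists>U'. C1_fun (\<lambda>x :: real^'a. legendre (\<sigma> i) (ref_coord M t x i)) U'" for i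
  proof -
    obtain p where p: "\<And>x. legendre (\<sigma> i) x = poly p x" using legendre_is_poly by metis
    have ref: "((\<lambda>x. ref_coord M t x i) has_derivative (\<lambda>h. vec_nth h i / (edge M / 2))) (at x)" for x
    proof -
      have "((\<lambda>x. vec_nth x i - c) has_derivative (\<lambda>h. vec_nth h i)) (at x)" for c
        by (auto intro!: derivative_eq_intros bounded_linear_imp_has_derivative bounded_linear_vec_nth)
      from bounded_linear.has_derivative[OF bounded_linear_divide this] show ?thesis
        unfolding ref_coord_def .
    qed
    have "((\<lambda>x. poly p (ref_coord M t x i)) has_derivative
        inner (axis i (poly (pderiv p) (ref_coord M t x i) / (edge M / 2)))) (at x)" for x
    proof -
      have "(poly p has_derivative (*) (poly (pderiv p) (ref_coord M t x i))) (at (ref_coord M t x i))"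
        using poly_DERIV[of p "ref_coord M t x i"] by (simp add: has_field_derivative_def)
      moreover have "inner (axis i c) = (\<lambda>h. c * vec_nth h i)" for c :: real
        by (auto simp: inner_commute[of "axis _ _"] inner_axis)
      ultimately show ?thesis
        by (intro has_derivative_eq_rhs[OF has_derivative_compose[OF ref]]) auto
    qed
    moreover have "continuous_on UNIV (\<lambda>x. axis i (poly (pderiv p) (ref_coord M t x i) / (edge M / 2)))"
    proof -
      have "continuous_on UNIV (\<lambda>x. ref_coord M t x i)"
        using ref by (meson continuous_at_imp_continuous_on has_derivative_continuous)
      then have "continuous_on UNIV
          (\<lambda>x. (poly (pderiv p) (ref_coord M t x i) / (edge M / 2)) *\<^sub>R axis i (1::real))"
        by (intro continuous_intros) (use edge in auto)
      moreover have "c *\<^sub>R axis i (1::real) = axis i c" for c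
        by (simp add: axis_def Finite_Cartesian_Product.vec_eq_iff)
      ultimately show ?thesis by simp
    qed
    ultimately show ?thesis
      unfolding p C1_fun_def
      by (intro exI[of _ "\<lambda>x. axis i (poly (pderiv p) (ref_coord M t x i) / (edge M / 2))"] conjI allI)
  qed
  then show ?thesis
    using C1_fun_prod[of UNIV "\<lambda>i x. legendre (\<sigma> i) (ref_coord M t x i)"]
    by (simp add: cell_poly_def b)
qed

text \<open>Agreement on open cells determines the traces and, up to null sets, the integrands on
  cells, and it is stable under linear combinations.\<close>

definition broken_C1 :: "'d::finite cart_mesh \<Rightarrow> (real^'d \<Rightarrow> real) \<Rightarrow> bool" where
  "broken_C1 M u \<longleftrightarrow> (\<forall>t\<in>cells M. \<exists>U U'. C1_fun U U' \<and> (\<forall>x\<in>interior (cell M t). u x = U x))"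

lemma broken_C1_linear:
  assumes "broken_C1 M u" "broken_C1 M v"
  shows "broken_C1 M (\<lambda>x. a * u x + b * v x)"
  unfolding broken_C1_def
proof
  fix t assume t: "t \<in> cells M"
  with assms obtain U U' V V' where "C1_fun U U'" "C1_fun V V'"
    "\<forall>x\<in>interior (cell M t). u x = U x" "\<forall>x\<in>interior (cell M t). v x = V x"
    unfolding broken_C1_def by metis
  then show "\<exists>W W'. C1_fun W W' \<and> (\<forall>x\<in>interior (cell M t). a * u x + b * v x = W x)"
    using C1_fun_linear[of U U' V V' a b] by (intro exI[of _ "\<lambda>x. a * U x + b * V x"]) auto
qed

lemma broken_C1_zero: "broken_C1 M (\<lambda>x. 0)"
  unfolding broken_C1_def using C1_fun_const[of 0] by blast

lemma broken_C1_sum: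
  assumes "finite I" "\<And>i. i \<in> I \<Longrightarrow> broken_C1 M (u i)"
  shows "broken_C1 M (\<lambda>x. \<Sum>i\<in>I. c i * u i x)"
  using assms
proof (induction I rule: finite_induct)
  case (insert i I)
  then show ?case using broken_C1_linear[of M "u i" "\<lambda>x. \<Sum>i\<in>I. c i * u i x" "c i" 1] by simp
qed (simp add: broken_C1_zero)

lemma interior_cell:
  "interior (cell M t) = box (\<chi> i. vec_nth (corner M) i + edge M * real (t i))
                             (\<chi> i. vec_nth (corner M) i + edge M * (real (t i) + 1))"
  by (simp add: cell_def interior_cbox)

text \<open>Open against closed cell: basis functions are cut off to closed cells, so this is what
  makes them vanish inside every other cell.\<close>

lemma interior_cell_disjoint:
  assumes h: "edge M > 0" and "s \<noteq> t" and x: "x \<in> interior (cell M s)"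
  shows "x \<notin> cell M t"
proof
  assume "x \<in> cell M t"
  obtain i where i: "s i \<noteq> t i" using \<open>s \<noteq> t\<close> by blast
  have "edge M * real (s i) < edge M * (real (t i) + 1)" "edge M * real (t i) < edge M * (real (s i) + 1)"
    using x[unfolded interior_cell mem_box_cart, rule_format, of i]
      \<open>x \<in> cell M t\<close>[unfolded cell_def mem_box_cart, rule_format, of i]
    by auto
  then show False using h i by auto
qed

lemma broken_C1_basis_fun:
  assumes "edge M > 0"
  shows "broken_C1 M (basis_fun M b)"
  unfolding broken_C1_def
proof
  fix s assume "s \<in> cells M"
  obtain t \<sigma> where b: "b = (t, \<sigma>)" by force
  show "\<exists>U U'. C1_fun U U' \<and> (\<forall>x\<in>interior (cell M s). basis_fun M b x = U x)"
  proof (cases "s = t")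
    case True
    then have "\<forall>x\<in>interior (cell M s). basis_fun M b x = cell_poly M b x"
      using interior_subset by (fastforce simp: b basis_fun_def cell_poly_def)
    then show ?thesis using C1_fun_cell_poly[OF assms] by blast
  next
    case False
    then have "\<forall>x\<in>interior (cell M s). basis_fun M b x = 0"
      using interior_cell_disjoint[OF assms False] by (auto simp: b basis_fun_def)
    then show ?thesis using C1_fun_const[of 0] by metis
  qed
qed

section \<open>One-sided traces on cells and faces\<close>

lemma at_within_interior_cell_nontrivial:
  assumes "edge M > 0" "x \<in> cell M t"
  shows "at x within interior (cell M t) \<noteq> bot"
proof -
  have "box (\<chi> i. vec_nth (corner M) i + edge M * real (t i))
            (\<chi> i. vec_nth (corner M) i + edge M * (real (t i) + 1)) \<noteq> {}"
    unfolding interval_ne_empty_cart using assms(1) by simp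
  then have "cell M t = closure (interior (cell M t))"
    unfolding interior_cell by (simp add: cell_def)
  then have "x \<in> closure (interior (cell M t))" using assms(2) by simp
  then have "x islimpt interior (cell M t)"
    by (metis closure_def interior_limit_point interior_interior UnE mem_Collect_eq)
  then show ?thesis by (simp add: trivial_limit_within)
qed

text \<open>\<open>Lim\<close> is determined only along a nontrivial filter, that is, because every
  point of the closed cell is approached from its interior.\<close>

lemma cell_trace_eq:
  assumes "edge M > 0" "x \<in> cell M t" "continuous_on UNIV W" "\<And>y. y \<in> interior (cell M t) \<Longrightarrow> w y = W y"
  shows "cell_trace M t w x = W x"
  unfolding cell_trace_def
proof (rule tendsto_Lim)
  show "at x within interior (cell M t) \<noteq> bot"
    using assms by (intro at_within_interior_cell_nontrivial)
  have "(W \<longlongrightarrow> W x) (at x within interior (cell M t))"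
    using assms(3) by (meson UNIV_I continuous_on_def tendsto_within_subset top_greatest)
  moreover have "eventually (\<lambda>y. w y = W y) (at x within interior (cell M t))"
    using assms(4) by (auto simp: eventually_at_filter)
  ultimately show "(w \<longlongrightarrow> W x) (at x within interior (cell M t))"
    by (simp add: tendsto_cong)
qed

lemma grad_eq:
  assumes "C1_fun U U'" "\<And>y. y \<in> interior (cell M t) \<Longrightarrow> u y = U y" "x \<in> interior (cell M t)"
  shows "grad u x = U' x"
proof -
  have "(U has_derivative inner (U' x)) (at x)" using assms(1) by (simp add: C1_fun_def)
  then have "(u has_derivative inner (U' x)) (at x)"
    by (rule has_derivative_transform_within_open[where s = "interior (cell M t)"]) (use assms in auto)
  then have "frechet_derivative u (at x) = inner (U' x)"
    by (metis frechet_derivative_at)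
  then show ?thesis by (simp add: grad_def Finite_Cartesian_Product.vec_eq_iff inner_axis)
qed

text \<open>One pair \<open>U\<close>, \<open>U'\<close> describes everything that the form can
  observe of \<open>u\<close> in the cell.\<close>

lemma broken_C1E:
  assumes "edge M > 0" "broken_C1 M u" "t \<in> cells M"
  obtains U U' where "C1_fun U U'" "\<And>x. x \<in> interior (cell M t) \<Longrightarrow> u x = U x"
    "\<And>x. x \<in> interior (cell M t) \<Longrightarrow> grad u x = U' x"
    "\<And>x. x \<in> cell M t \<Longrightarrow> cell_trace M t u x = U x"
    "\<And>x. x \<in> cell M t \<Longrightarrow> cell_trace M t (grad u) x = U' x"
proof -
  obtain U U' where U: "C1_fun U U'" "\<And>x. x \<in> interior (cell M t) \<Longrightarrow> u x = U x"
    using assms unfolding broken_C1_def by metis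
  have g: "\<And>x. x \<in> interior (cell M t) \<Longrightarrow> grad u x = U' x" using grad_eq[OF U] .
  show thesis
    by (rule that[OF U g])
       (use U g C1_fun_continuous[OF U(1)] assms(1) in \<open>auto intro!: cell_trace_eq simp: C1_fun_def\<close>)
qed

locale cartesian_mesh =
  fixes M :: "'d::finite cart_mesh"
  assumes edge_pos: "edge M > 0" and extent_pos: "extent M i > 0"
begin

lemma cell_trace_linear:
  assumes u: "broken_C1 M u" and v: "broken_C1 M v" and t: "t \<in> cells M" and x: "x \<in> cell M t"
  shows "cell_trace M t (\<lambda>x. a * u x + b * v x) x = a * cell_trace M t u x + b * cell_trace M t v x"
    and "cell_trace M t (grad (\<lambda>x. a * u x + b * v x)) x
      = a *\<^sub>R cell_trace M t (grad u) x + b *\<^sub>R cell_trace M t (grad v) x"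
proof -
  obtain U U' where U: "C1_fun U U'" "\<And>x. x \<in> interior (cell M t) \<Longrightarrow> u x = U x"
    "cell_trace M t u x = U x" "cell_trace M t (grad u) x = U' x"
    using broken_C1E[OF edge_pos u t] x by metis
  obtain V V' where V: "C1_fun V V'" "\<And>x. x \<in> interior (cell M t) \<Longrightarrow> v x = V x"
    "cell_trace M t v x = V x" "cell_trace M t (grad v) x = V' x"
    using broken_C1E[OF edge_pos v t] x by metis
  note W = C1_fun_linear[OF U(1) V(1), of a b]
  show "cell_trace M t (\<lambda>x. a * u x + b * v x) x = a * cell_trace M t u x + b * cell_trace M t v x"
    unfolding U(3) V(3)
    by (rule cell_trace_eq[OF edge_pos x]) (use C1_fun_continuous[OF W] U(2) V(2) in auto)
  show "cell_trace M t (grad (\<lambda>x. a * u x + b * v x)) x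
      = a *\<^sub>R cell_trace M t (grad u) x + b *\<^sub>R cell_trace M t (grad v) x"
    unfolding U(4) V(4)
    by (rule cell_trace_eq[OF edge_pos x])
       (use W U(2) V(2) in \<open>auto simp: C1_fun_def intro!: grad_eq[OF W, of M t]\<close>)
qed

lemma continuous_on_cell_trace:
  assumes u: "broken_C1 M u" and t: "t \<in> cells M"
  shows "continuous_on (cell M t) (cell_trace M t u)"
    and "continuous_on (cell M t) (cell_trace M t (grad u))"
proof -
  obtain U U' where U: "C1_fun U U'" "\<And>x. x \<in> cell M t \<Longrightarrow> cell_trace M t u x = U x"
    "\<And>x. x \<in> cell M t \<Longrightarrow> cell_trace M t (grad u) x = U' x"
    using broken_C1E[OF edge_pos u t] by metis
  have "continuous_on (cell M t) U" "continuous_on (cell M t) U'"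
    using U(1) C1_fun_continuous[OF U(1)] by (auto simp: C1_fun_def intro: continuous_on_subset)
  then show "continuous_on (cell M t) (cell_trace M t u)"
    "continuous_on (cell M t) (cell_trace M t (grad u))"
    using U(2,3) by (simp_all cong: continuous_on_cong)
qed

text \<open>A box degenerate in direction \<open>i\<close>, which yields compactness and Borel
  measurability at once.\<close>

lemma face_set_eq_cbox:
  "face_set M (i, q) = cbox
     (\<chi> j. vec_nth (corner M) j + edge M * real (q j))
     (\<chi> j. vec_nth (corner M) j + edge M * (if j = i then real (q j) else real (q j) + 1))"
proof -
  have all: "(\<forall>j. P j) \<longleftrightarrow> P i \<and> (\<forall>j. j \<noteq> i \<longrightarrow> P j)" for P by metis
  show ?thesis
    unfolding set_eq_iff mem_box_cart by (subst all) (auto simp: face_set_def face_level_def)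
qed

lemma face_set_subset_cell: "face_set M (i, q) \<subseteq> cell M q"
proof
  fix x assume "x \<in> face_set M (i, q)"
  then have *: "vec_nth (corner M) j + edge M * real (q j) \<le> vec_nth x j \<and>
      vec_nth x j \<le> vec_nth (corner M) j + edge M * (if j = i then real (q j) else real (q j) + 1)" for j
    by (simp add: face_set_eq_cbox mem_box_cart)
  have "vec_nth (corner M) j + edge M * real (q j) \<le> vec_nth x j \<and>
      vec_nth x j \<le> vec_nth (corner M) j + edge M * (real (q j) + 1)" for j
    using *[of j] edge_pos by (cases "j = i") (auto simp: distrib_left)
  then show "x \<in> cell M q"
    by (simp add: cell_def mem_box_cart)
qed

text \<open>The face is also the top of the cell below it. The premise keeps the truncated
  subtraction in \<open>q i - 1\<close> exact.\<close>

lemma face_set_subset_lower_cell: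
  assumes "0 < q i"
  shows "face_set M (i, q) \<subseteq> cell M (q(i := q i - 1))"
proof
  fix x assume "x \<in> face_set M (i, q)"
  then have *: "vec_nth (corner M) j + edge M * real (q j) \<le> vec_nth x j \<and>
      vec_nth x j \<le> vec_nth (corner M) j + edge M * (if j = i then real (q j) else real (q j) + 1)" for j
    by (simp add: face_set_eq_cbox mem_box_cart)
  have "real (q i - 1) = real (q i) - 1" using assms by simp
  then have "vec_nth (corner M) j + edge M * real ((q(i := q i - 1)) j) \<le> vec_nth x j \<and>
      vec_nth x j \<le> vec_nth (corner M) j + edge M * (real ((q(i := q i - 1)) j) + 1)" for j
    using *[of j] edge_pos by (cases "j = i") (auto simp: right_diff_distrib)
  then show "x \<in> cell M (q(i := q i - 1))"
    by (simp add: cell_def mem_box_cart)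
qed

lemma face_cells:
  assumes "(i, q) \<in> faces M"
  shows "q i \<noteq> extent M i \<Longrightarrow> q \<in> cells M" and "0 < q i \<Longrightarrow> q(i := q i - 1) \<in> cells M"
proof -
  have q: "q i \<le> extent M i" "\<And>j. j \<noteq> i \<Longrightarrow> q j < extent M j" using assms by (auto simp: faces_def)
  show "q \<in> cells M" if "q i \<noteq> extent M i"
    unfolding cells_def mem_Collect_eq using q that by (metis le_neq_implies_less)
  show "q(i := q i - 1) \<in> cells M" if "0 < q i"
    using q that by (auto simp: cells_def)
qed

lemma face_traces_linear:
  assumes u: "broken_C1 M u" and v: "broken_C1 M v" and F: "F \<in> faces M" and x: "x \<in> face_set M F"
  shows "face_jump M F (\<lambda>x. a * u x + b * v x) x = a * face_jump M F u x + b * face_jump M F v x"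
    and "face_avg M F (grad (\<lambda>x. a * u x + b * v x)) x
      = a *\<^sub>R face_avg M F (grad u) x + b *\<^sub>R face_avg M F (grad v) x"
proof -
  obtain i q where F_eq: "F = (i, q)" by force
  note upper = cell_trace_linear[OF u v face_cells(1)[OF F[unfolded F_eq]]
      subsetD[OF face_set_subset_cell x[unfolded F_eq]], of a b]
  note lower = cell_trace_linear[OF u v face_cells(2)[OF F[unfolded F_eq]]
      subsetD[OF face_set_subset_lower_cell x[unfolded F_eq]], of a b]
  show "face_jump M F (\<lambda>x. a * u x + b * v x) x = a * face_jump M F u x + b * face_jump M F v x"
    using upper(1) lower(1) extent_pos[of i] by (auto simp: F_eq face_jump_def algebra_simps)
  show "face_avg M F (grad (\<lambda>x. a * u x + b * v x)) x
      = a *\<^sub>R face_avg M F (grad u) x + b *\<^sub>R face_avg M F (grad v) x"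
    using upper(2) lower(2) extent_pos[of i] by (auto simp: F_eq face_avg_def algebra_simps)
qed

lemma continuous_on_face_traces:
  assumes u: "broken_C1 M u" and F: "F \<in> faces M"
  shows "continuous_on (face_set M F) (face_jump M F u)"
    and "continuous_on (face_set M F) (face_avg M F (grad u))"
proof -
  obtain i q where F_eq: "F = (i, q)" by force
  note upper = continuous_on_cell_trace[OF u face_cells(1)[OF F[unfolded F_eq]],
      THEN continuous_on_subset, OF _ face_set_subset_cell]
  note lower = continuous_on_cell_trace[OF u face_cells(2)[OF F[unfolded F_eq]],
      THEN continuous_on_subset, OF _ face_set_subset_lower_cell]
  \<comment> \<open>\<open>extent_pos\<close> rules out \<open>q i = 0 = extent M i\<close>, so at
    least one adjacent cell belongs to the mesh.\<close>
  consider "q i = 0" "q i \<noteq> extent M i" | "0 < q i" "q i = extent M i" | "0 < q i" "q i \<noteq> extent M i"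
    using extent_pos[of i] by fastforce
  note cases = this
  from cases show "continuous_on (face_set M F) (face_jump M F u)"
  proof cases
    case 1
    then show ?thesis using upper(1)[OF 1(2)] by (simp add: F_eq face_jump_def)
  next
    case 2
    then show ?thesis using lower(1)[OF 2(1) 2(1)] by (simp add: F_eq face_jump_def)
  next
    case 3
    then show ?thesis using continuous_on_diff[OF lower(1)[OF 3(1) 3(1)] upper(1)[OF 3(2)]]
      by (simp add: F_eq face_jump_def)
  qed
  from cases show "continuous_on (face_set M F) (face_avg M F (grad u))"
  proof cases
    case 1
    then show ?thesis using upper(2)[OF 1(2)] by (simp add: F_eq face_avg_def)
  next
    case 2
    then show ?thesis using lower(2)[OF 2(1) 2(1)] by (simp add: F_eq face_avg_def)
  next
    case 3
    then show ?thesis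
      using continuous_on_scaleR[OF continuous_on_const[of _ "1/2"]
          continuous_on_add[OF lower(2)[OF 3(1) 3(1)] upper(2)[OF 3(2)]]]
      by (simp add: F_eq face_avg_def)
  qed
qed

end

section \<open>Integration over faces and cells\<close>

lemma measurable_hyperplane_embedding [measurable]:
  "(\<lambda>y. \<chi> j. if j = i then (s :: real) else y j) \<in> borel_measurable (\<Pi>\<^sub>M j\<in>UNIV - {i}. lborel)"
proof (rule borel_measurable_euclidean_space[THEN iffD2], rule ballI)
  fix b :: "real^'a" assume "b \<in> Basis"
  then obtain j where b: "b = axis j 1" by (auto simp: Basis_vec_def)
  have "(\<lambda>y. if j = i then s else y j) \<in> borel_measurable (\<Pi>\<^sub>M j\<in>UNIV - {i}. lborel)"
  proof (cases "j = i")
    case False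
    then have "(\<lambda>y. y j) \<in> measurable (\<Pi>\<^sub>M j\<in>UNIV - {i}. lborel) lborel"
      by (intro measurable_component_singleton) auto
    then show ?thesis using False by simp
  qed simp
  then show "(\<lambda>y. inner (\<chi> j. if j = i then s else y j) b) \<in> borel_measurable (\<Pi>\<^sub>M j\<in>UNIV - {i}. lborel)"
    by (simp add: b inner_axis)
qed

lemma sets_hyperplane_measure [simp, measurable_cong]: "sets (hyperplane_measure i s) = sets borel"
  by (simp add: hyperplane_measure_def)

context cartesian_mesh
begin

lemma face_embedding_mem_iff:
  assumes "y \<in> extensional (UNIV - {i})"
  shows "(\<chi> j. if j = i then face_level M (i, q) else y j) \<in> face_set M (i, q) \<longleftrightarrow>
    y \<in> (\<Pi>\<^sub>E j\<in>UNIV - {i}. {vec_nth (corner M) j + edge M * real (q j)..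
                             vec_nth (corner M) j + edge M * (real (q j) + 1)})"
  using assms by (auto simp: face_set_def PiE_iff)

lemma face_embedding_vimage:
  "(\<lambda>y. \<chi> j. if j = i then face_level M (i, q) else y j) -` face_set M (i, q)
      \<inter> space (\<Pi>\<^sub>M j\<in>UNIV - {i}. lborel)
    = (\<Pi>\<^sub>E j\<in>UNIV - {i}. {vec_nth (corner M) j + edge M * real (q j)..
                             vec_nth (corner M) j + edge M * (real (q j) + 1)})"
proof (rule Set.set_eqI)
  fix y :: "'d \<Rightarrow> real"
  show "y \<in> (\<lambda>y. \<chi> j. if j = i then face_level M (i, q) else y j) -` face_set M (i, q)
      \<inter> space (\<Pi>\<^sub>M j\<in>UNIV - {i}. lborel) \<longleftrightarrow>
    y \<in> (\<Pi>\<^sub>E j\<in>UNIV - {i}. {vec_nth (corner M) j + edge M * real (q j)..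
                             vec_nth (corner M) j + edge M * (real (q j) + 1)})"
    by (cases "y \<in> extensional (UNIV - {i})")
       (simp_all add: face_embedding_mem_iff space_PiM PiE_def)
qed

text \<open>The face has the measure of a product of intervals (an empty product, of value one, if
  \<open>d = 1\<close>), which makes bounded measurable functions on it integrable.\<close>

lemma emeasure_face_set_finite:
  "emeasure (hyperplane_measure i (face_level M (i, q))) (face_set M (i, q)) < \<infinity>"
proof -
  interpret product_sigma_finite "\<lambda>j :: 'd. lborel :: real measure" ..
  let ?I = "\<lambda>j. {vec_nth (corner M) j + edge M * real (q j)..vec_nth (corner M) j + edge M * (real (q j) + 1)}"
  have closed: "face_set M (i, q) \<in> sets borel" by (simp add: face_set_eq_cbox)
  have "emeasure (hyperplane_measure i (face_level M (i, q))) (face_set M (i, q))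
      = emeasure (\<Pi>\<^sub>M j\<in>UNIV - {i}. lborel) (\<Pi>\<^sub>E j\<in>UNIV - {i}. ?I j)"
    unfolding hyperplane_measure_def emeasure_distr[OF measurable_hyperplane_embedding closed]
      face_embedding_vimage ..
  also have "\<dots> = (\<Prod>j\<in>UNIV - {i}. emeasure lborel (?I j))"
    by (rule emeasure_PiM) auto
  also have "\<dots> < \<infinity>"
    by (auto simp: less_top[symmetric] ennreal_prod_eq_top emeasure_lborel_Icc_eq)
  finally show ?thesis .
qed

lemma face_integrable:
  fixes f :: "real^'d \<Rightarrow> real"
  assumes "continuous_on (face_set M F) f"
  shows "set_integrable (hyperplane_measure (fst F) (face_level M F)) (face_set M F) f"
proof -
  obtain i q where F: "F = (i, q)" by force
  have compact: "compact (face_set M F)" by (simp add: F face_set_eq_cbox)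
  then have borel: "face_set M F \<in> sets borel" by (rule borel_compact)
  obtain B where B: "\<And>x. x \<in> face_set M F \<Longrightarrow> norm (f x) \<le> B"
    using compact_continuous_image[OF assms compact, THEN compact_imp_bounded]
    by (auto simp: bounded_iff)
  \<comment> \<open>The function is controlled only on the face, so its truncation takes its place,
    and the indicator is repeated to fit the integrability criterion.\<close>
  have "integrable (hyperplane_measure (fst F) (face_level M F))
      (\<lambda>x. indicator (face_set M F) x *\<^sub>R (indicator (face_set M F) x *\<^sub>R f x))"
  proof (rule integrableI_bounded_set_indicator[where B = B])
    show "(\<lambda>x. indicator (face_set M F) x *\<^sub>R f x) \<in> borel_measurable (hyperplane_measure (fst F) (face_level M F))"
      using borel_measurable_continuous_on_indicator[OF borel assms]
      by (simp cong: measurable_cong_sets)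
    show "emeasure (hyperplane_measure (fst F) (face_level M F)) (face_set M F) < \<infinity>"
      using emeasure_face_set_finite by (simp add: F)
  qed (use borel B in auto)
  moreover have "(\<lambda>x. indicator (face_set M F) x *\<^sub>R (indicator (face_set M F) x *\<^sub>R f x))
      = (\<lambda>x. indicator (face_set M F) x *\<^sub>R f x)"
    by (auto simp: indicator_def)
  ultimately show ?thesis by (simp add: set_integrable_def)
qed

lemma face_integral_cong:
  "(\<And>x. x \<in> face_set M F \<Longrightarrow> f x = g x) \<Longrightarrow> face_integral M F f = face_integral M F g"
  unfolding face_integral_def set_lebesgue_integral_def
  by (rule Bochner_Integration.integral_cong) (auto simp: indicator_def)

lemma face_integral_linear:
  assumes "continuous_on (face_set M F) f" "continuous_on (face_set M F) g"
  shows "face_integral M F (\<lambda>x. a * f x + b * g x) = a * face_integral M F f + b * face_integral M F g"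
  unfolding face_integral_def
  using assms[THEN face_integrable] by (subst set_integral_add) auto

text \<open>The frontier of a cell is a null set, so the uncontrolled gradients there do not affect
  the integral.\<close>

lemma integral_cell_eq:
  assumes "\<And>x. x \<in> interior (cell M t) \<Longrightarrow> f x = (g x :: real)"
  shows "integral (cell M t) f = integral (cell M t) g"
  by (rule integral_spike[OF negligible_frontier_interval])
     (use assms in \<open>auto simp: cell_def interior_cbox\<close>)

lemma integral_cell_grad_linear:
  assumes u: "broken_C1 M u" and v: "broken_C1 M v" and w: "broken_C1 M w" and t: "t \<in> cells M"
  shows "integral (cell M t) (\<lambda>x. inner (grad (\<lambda>x. a * u x + b * v x) x) (grad w x))
    = a * integral (cell M t) (\<lambda>x. inner (grad u x) (grad w x))
    + b * integral (cell M t) (\<lambda>x. inner (grad v x) (grad w x))"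
proof -
  obtain U U' where U: "C1_fun U U'" "\<And>x. x \<in> interior (cell M t) \<Longrightarrow> u x = U x"
    "\<And>x. x \<in> interior (cell M t) \<Longrightarrow> grad u x = U' x"
    using broken_C1E[OF edge_pos u t] by metis
  obtain V V' where V: "C1_fun V V'" "\<And>x. x \<in> interior (cell M t) \<Longrightarrow> v x = V x"
    "\<And>x. x \<in> interior (cell M t) \<Longrightarrow> grad v x = V' x"
    using broken_C1E[OF edge_pos v t] by metis
  obtain W W' where W: "C1_fun W W'" "\<And>x. x \<in> interior (cell M t) \<Longrightarrow> grad w x = W' x"
    using broken_C1E[OF edge_pos w t] by metis
  have grad: "grad (\<lambda>x. a * u x + b * v x) x = a *\<^sub>R U' x + b *\<^sub>R V' x" if "x \<in> interior (cell M t)" for x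
    by (rule grad_eq[OF C1_fun_linear[OF U(1) V(1)] _ that]) (use U(2) V(2) in auto)
  have integrable: "(\<lambda>x. inner (X x) (W' x)) integrable_on cell M t"
    if "continuous_on UNIV X" for X :: "real^'d \<Rightarrow> real^'d"
    unfolding cell_def
    by (intro integrable_continuous continuous_on_inner)
       (use that W(1) in \<open>auto simp: C1_fun_def intro: continuous_on_subset\<close>)
  have "integral (cell M t) (\<lambda>x. inner (grad (\<lambda>x. a * u x + b * v x) x) (grad w x))
      = integral (cell M t) (\<lambda>x. a * inner (U' x) (W' x) + b * inner (V' x) (W' x))"
    by (rule integral_cell_eq) (simp add: grad W(2) inner_add_left)
  also have "\<dots> = a * integral (cell M t) (\<lambda>x. inner (U' x) (W' x))
      + b * integral (cell M t) (\<lambda>x. inner (V' x) (W' x))"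
    using U(1) V(1) by (subst integral_add) (auto intro!: integrable integrable_on_mult_right simp: C1_fun_def)
  also have "integral (cell M t) (\<lambda>x. inner (U' x) (W' x)) = integral (cell M t) (\<lambda>x. inner (grad u x) (grad w x))"
    by (rule integral_cell_eq) (simp add: U(3) W(2))
  also have "integral (cell M t) (\<lambda>x. inner (V' x) (W' x)) = integral (cell M t) (\<lambda>x. inner (grad v x) (grad w x))"
    by (rule integral_cell_eq) (simp add: V(3) W(2))
  finally show ?thesis .
qed

section \<open>Bilinearity and symmetry of the interior penalty form\<close>

lemma sum_linear:
  fixes f g h :: "'z \<Rightarrow> real"
  assumes "\<And>F. F \<in> S \<Longrightarrow> f F = a * g F + b * h F"
  shows "(\<Sum>F\<in>S. f F) = a * (\<Sum>F\<in>S. g F) + b * (\<Sum>F\<in>S. h F)"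
  using assms by (simp add: sum.distrib sum_distrib_left)

lemma sip_form_linear_left:
  assumes u: "broken_C1 M u" and v: "broken_C1 M v" and w: "broken_C1 M w"
  shows "sip_form \<alpha> M k (\<lambda>x. a * u x + b * v x) w = a * sip_form \<alpha> M k u w + b * sip_form \<alpha> M k v w"
proof -
  let ?n = face_normal
  have avg: "face_integral M F (\<lambda>x. inner (face_avg M F (grad (\<lambda>x. a * u x + b * v x)) x) (?n F) * face_jump M F w x)
      = a * face_integral M F (\<lambda>x. inner (face_avg M F (grad u) x) (?n F) * face_jump M F w x)
      + b * face_integral M F (\<lambda>x. inner (face_avg M F (grad v) x) (?n F) * face_jump M F w x)"
    if F: "F \<in> faces M" for F
  proof -
    have "face_integral M F (\<lambda>x. inner (face_avg M F (grad (\<lambda>x. a * u x + b * v x)) x) (?n F) * face_jump M F w x)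
      = face_integral M F (\<lambda>x. a * (inner (face_avg M F (grad u) x) (?n F) * face_jump M F w x)
          + b * (inner (face_avg M F (grad v) x) (?n F) * face_jump M F w x))"
      by (rule face_integral_cong) (simp add: face_traces_linear(2)[OF u v F] inner_add_left algebra_simps)
    also have "\<dots> = a * face_integral M F (\<lambda>x. inner (face_avg M F (grad u) x) (?n F) * face_jump M F w x)
        + b * face_integral M F (\<lambda>x. inner (face_avg M F (grad v) x) (?n F) * face_jump M F w x)"
      by (rule face_integral_linear)
         (intro continuous_intros continuous_on_face_traces[OF u F] continuous_on_face_traces[OF v F]
           continuous_on_face_traces[OF w F])+
    finally show ?thesis .
  qed
  \<comment> \<open>The weight \<open>G\<close> is arbitrary so that one computation serves both the
    symmetrising and the penalty term.\<close>
  have jump: "face_integral M F (\<lambda>x. G x * face_jump M F (\<lambda>x. a * u x + b * v x) x)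
      = a * face_integral M F (\<lambda>x. G x * face_jump M F u x)
      + b * face_integral M F (\<lambda>x. G x * face_jump M F v x)"
    if F: "F \<in> faces M" and G: "continuous_on (face_set M F) G" for F G
  proof -
    have "face_integral M F (\<lambda>x. G x * face_jump M F (\<lambda>x. a * u x + b * v x) x)
      = face_integral M F (\<lambda>x. a * (G x * face_jump M F u x) + b * (G x * face_jump M F v x))"
      by (rule face_integral_cong) (simp add: face_traces_linear(1)[OF u v F] algebra_simps)
    also have "\<dots> = a * face_integral M F (\<lambda>x. G x * face_jump M F u x)
        + b * face_integral M F (\<lambda>x. G x * face_jump M F v x)"
      by (rule face_integral_linear)
         (intro continuous_intros G continuous_on_face_traces[OF u F] continuous_on_face_traces[OF v F])+
    finally show ?thesis .
  qed
  have avg': "face_integral M F (\<lambda>x. inner (face_avg M F (grad w) x) (?n F) * face_jump M F (\<lambda>x. a * u x + b * v x) x)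
      = a * face_integral M F (\<lambda>x. inner (face_avg M F (grad w) x) (?n F) * face_jump M F u x)
      + b * face_integral M F (\<lambda>x. inner (face_avg M F (grad w) x) (?n F) * face_jump M F v x)"
    if F: "F \<in> faces M" for F
    by (rule jump[OF F]) (auto intro!: continuous_intros continuous_on_face_traces[OF w F])
  have pen: "face_integral M F (\<lambda>x. face_jump M F (\<lambda>x. a * u x + b * v x) x * face_jump M F w x)
      = a * face_integral M F (\<lambda>x. face_jump M F u x * face_jump M F w x)
      + b * face_integral M F (\<lambda>x. face_jump M F v x * face_jump M F w x)"
    if F: "F \<in> faces M" for F
    using jump[OF F continuous_on_face_traces(1)[OF w F]] by (simp add: mult.commute)
  \<comment> \<open>Naming the four sums as functions of the first argument leaves a purely linear
    identity.\<close>
  define vol where "vol z = (\<Sum>t\<in>cells M. integral (cell M t) (\<lambda>x. inner (grad z x) (grad w x)))" for z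
  define cons where "cons z = (\<Sum>F\<in>faces M. face_integral M F
    (\<lambda>x. inner (face_avg M F (grad z) x) (?n F) * face_jump M F w x))" for z
  define symm where "symm z = (\<Sum>F\<in>faces M. face_integral M F
    (\<lambda>x. inner (face_avg M F (grad w) x) (?n F) * face_jump M F z x))" for z
  define stab where "stab z = (\<Sum>F\<in>faces M. \<alpha> * (real k)\<^sup>2 / edge M *
    face_integral M F (\<lambda>x. face_jump M F z x * face_jump M F w x))" for z
  have sip: "sip_form \<alpha> M k z w = vol z - cons z - symm z + stab z" for z
    by (simp only: sip_form_def vol_def cons_def symm_def stab_def)
  have "vol (\<lambda>x. a * u x + b * v x) = a * vol u + b * vol v"
    unfolding vol_def by (rule sum_linear) (rule integral_cell_grad_linear[OF u v w])
  moreover have "cons (\<lambda>x. a * u x + b * v x) = a * cons u + b * cons v"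
    unfolding cons_def by (rule sum_linear) (rule avg)
  moreover have "symm (\<lambda>x. a * u x + b * v x) = a * symm u + b * symm v"
    unfolding symm_def by (rule sum_linear) (rule avg')
  moreover have "stab (\<lambda>x. a * u x + b * v x) = a * stab u + b * stab v"
    unfolding stab_def by (rule sum_linear) (simp only: pen, simp add: algebra_simps)
  ultimately show ?thesis unfolding sip by (simp add: algebra_simps)
qed

text \<open>Swapping the arguments exchanges the two consistency sums. Linearity in the second
  argument then follows from that in the first.\<close>

lemma sip_form_commute: "sip_form \<alpha> M k u v = sip_form \<alpha> M k v u"
proof -
  have "inner (grad u x) (grad v x) = inner (grad v x) (grad u x)" for x by (rule inner_commute)
  moreover have "face_jump M F u x * face_jump M F v x = face_jump M F v x * face_jump M F u x" for F x
    by (rule mult.commute)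
  ultimately show ?thesis unfolding sip_form_def by (simp only:)
qed

lemma sip_form_sum_left:
  assumes "finite I" "\<And>i. i \<in> I \<Longrightarrow> broken_C1 M (u i)" "broken_C1 M w"
  shows "sip_form \<alpha> M k (\<lambda>x. \<Sum>i\<in>I. c i * u i x) w = (\<Sum>i\<in>I. c i * sip_form \<alpha> M k (u i) w)"
  using assms
proof (induction I rule: finite_induct)
  case empty
  then show ?case using sip_form_linear_left[OF empty(2) empty(2) empty(2), of \<alpha> k 0 0] by simp
next
  case (insert i I)
  then show ?case
    using sip_form_linear_left[of "u i" "\<lambda>x. \<Sum>i\<in>I. c i * u i x" w \<alpha> k "c i" 1]
      broken_C1_sum[of I M u c] by simp
qed

end

section \<open>The stiffness matrix\<close>

text \<open>By continuity one nonzero value suffices; it is placed at the right end because that is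
  where the Legendre factors are known.\<close>

lemma set_integral_square_pos:
  fixes f :: "real \<Rightarrow> real"
  assumes "a < b" "continuous_on {a..b} f" "f b \<noteq> 0"
  shows "0 < (LINT x:{a..b}|lborel. (f x)\<^sup>2)"
proof -
  have cont: "continuous_on {a..b} (\<lambda>x. (f x)\<^sup>2)" using assms(2) by (intro continuous_intros)
  have "(LINT x:{a..b}|lborel. (f x)\<^sup>2) = integral {a..b} (\<lambda>x. (f x)\<^sup>2)"
    by (rule set_borel_integral_eq_integral(2)[OF borel_integrable_atLeastAtMost'[OF cont]])
  moreover have "integral {a..b} (\<lambda>x. (f x)\<^sup>2) \<noteq> 0"
    using integral_eq_0_iff[OF cont assms(1)] assms by force
  moreover have "0 \<le> integral {a..b} (\<lambda>x. (f x)\<^sup>2)"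
    by (rule integral_nonneg[OF integrable_continuous_real[OF cont]]) simp
  ultimately show ?thesis by simp
qed

context cartesian_mesh
begin

lemma finite_faces: "finite (faces M)"
proof (rule finite_subset)
  show "faces M \<subseteq> UNIV \<times> (\<Pi>\<^sub>E j\<in>UNIV. {..extent M j})"
  proof
    fix F assume "F \<in> faces M"
    then obtain i q where F: "F = (i, q)" "q i \<le> extent M i" "\<And>j. j \<noteq> i \<Longrightarrow> q j < extent M j"
      by (auto simp: faces_def)
    then have "q j \<le> extent M j" for j by (cases "j = i") (auto intro: less_imp_le)
    then show "F \<in> UNIV \<times> (\<Pi>\<^sub>E j\<in>UNIV. {..extent M j})" by (auto simp: F(1))
  qed
qed (intro finite_cartesian_product finite_PiE; simp)

text \<open>On the face the polynomial splits into a factor of modulus one, from the fixed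
  coordinate, and one Legendre factor for each remaining coordinate. The integral is therefore a
  product of one-dimensional integrals, all positive because each factor equals one at the right end
  of its interval.\<close>

lemma face_integral_cell_poly_square_pos:
  "0 < face_integral M (i, t) (\<lambda>x. (cell_poly M (t, \<sigma>) x)\<^sup>2)"
proof -
  interpret product_sigma_finite "\<lambda>j :: 'd. lborel :: real measure" ..
  let ?emb = "\<lambda>y. \<chi> j. if j = i then face_level M (i, t) else y j"
  let ?I = "\<lambda>j. {vec_nth (corner M) j + edge M * real (t j)..vec_nth (corner M) j + edge M * (real (t j) + 1)}"
  define f where "f j s = legendre (\<sigma> j)
    ((s - (vec_nth (corner M) j + edge M * (real (t j) + 1/2))) / (edge M / 2))" for j s
  have f_cont: "continuous_on S (f j)" for S j
    unfolding f_def using edge_pos by (intro continuous_intros) auto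
  obtain P' where "C1_fun (cell_poly M (t, \<sigma>)) P'" using C1_fun_cell_poly[OF edge_pos] by blast
  then have cont: "continuous_on (face_set M (i, t)) (\<lambda>x. (cell_poly M (t, \<sigma>) x)\<^sup>2)"
    by (intro continuous_intros continuous_on_subset[OF C1_fun_continuous]) auto
  have borel: "face_set M (i, t) \<in> sets borel" by (simp add: face_set_eq_cbox)
  \<comment> \<open>The face \<open>(i, t)\<close> bounds the cell \<open>t\<close> from below, so
    the reference coordinate in direction \<open>i\<close> is -1.\<close>
  have level: "f i (face_level M (i, t)) = (-1) ^ \<sigma> i"
  proof -
    have "(face_level M (i, t) - (vec_nth (corner M) i + edge M * (real (t i) + 1/2))) / (edge M / 2) = - 1"
      using edge_pos by (simp add: face_level_def field_simps)
    then show ?thesis by (simp add: f_def legendre_at_ends)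
  qed
  have pointwise: "indicator (face_set M (i, t)) (?emb y) *\<^sub>R (cell_poly M (t, \<sigma>) (?emb y))\<^sup>2
      = (\<Prod>j\<in>UNIV - {i}. indicator (?I j) (y j) *\<^sub>R (f j (y j))\<^sup>2)"
    if y: "y \<in> space (\<Pi>\<^sub>M j\<in>UNIV - {i}. lborel)" for y
  proof -
    have ext: "y \<in> extensional (UNIV - {i})" using y by (simp add: space_PiM PiE_def)
    have mem: "?emb y \<in> face_set M (i, t) \<longleftrightarrow> (\<forall>j\<in>UNIV - {i}. y j \<in> ?I j)"
      unfolding face_embedding_mem_iff[OF ext] using ext by (auto simp: PiE_def Pi_def)
    have "cell_poly M (t, \<sigma>) (?emb y) = (\<Prod>j\<in>UNIV. f j (vec_nth (?emb y) j))"
      unfolding cell_poly_def f_def ref_coord_def by simp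
    also have "\<dots> = f i (vec_nth (?emb y) i) * (\<Prod>j\<in>UNIV - {i}. f j (vec_nth (?emb y) j))"
      by (rule prod.remove) auto
    also have "\<dots> = (-1) ^ \<sigma> i * (\<Prod>j\<in>UNIV - {i}. f j (y j))"
      using level by simp
    finally have poly: "(cell_poly M (t, \<sigma>) (?emb y))\<^sup>2 = (\<Prod>j\<in>UNIV - {i}. (f j (y j))\<^sup>2)"
      by (simp add: power_mult_distrib prod_power_distrib flip: power_mult)
    show ?thesis
    proof (cases "\<forall>j\<in>UNIV - {i}. y j \<in> ?I j")
      case True
      have "(\<Prod>j\<in>UNIV - {i}. indicator (?I j) (y j) *\<^sub>R (f j (y j))\<^sup>2)
          = (\<Prod>j\<in>UNIV - {i}. (f j (y j))\<^sup>2)"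
        by (rule prod.cong) (use True in \<open>auto simp: indicator_def\<close>)
      then show ?thesis using mem True unfolding poly by simp
    next
      case False
      then obtain j where j: "j \<in> UNIV - {i}" "y j \<notin> ?I j" by blast
      have "(\<Prod>j\<in>UNIV - {i}. indicator (?I j) (y j) *\<^sub>R (f j (y j))\<^sup>2) = 0"
        by (rule prod_zero) (use j in \<open>auto intro!: bexI[of _ j] simp: indicator_def\<close>)
      then show ?thesis using mem False by simp
    qed
  qed
  have "face_integral M (i, t) (\<lambda>x. (cell_poly M (t, \<sigma>) x)\<^sup>2)
      = (\<integral>y. indicator (face_set M (i, t)) (?emb y) *\<^sub>R (cell_poly M (t, \<sigma>) (?emb y))\<^sup>2 \<partial>(\<Pi>\<^sub>M j\<in>UNIV - {i}. lborel))"
    unfolding face_integral_def set_lebesgue_integral_def fst_conv hyperplane_measure_def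
    by (rule integral_distr[OF measurable_hyperplane_embedding
          borel_measurable_continuous_on_indicator[OF borel cont]])
  also have "\<dots> = (\<integral>y. (\<Prod>j\<in>UNIV - {i}. indicator (?I j) (y j) *\<^sub>R (f j (y j))\<^sup>2) \<partial>(\<Pi>\<^sub>M j\<in>UNIV - {i}. lborel))"
    by (rule Bochner_Integration.integral_cong[OF refl pointwise])
  also have "\<dots> = (\<Prod>j\<in>UNIV - {i}. LINT s|lborel. indicator (?I j) s *\<^sub>R (f j s)\<^sup>2)"
  proof (rule product_integral_prod)
    fix j
    show "integrable lborel (\<lambda>s. indicator (?I j) s *\<^sub>R (f j s)\<^sup>2)"
      using borel_integrable_atLeastAtMost'[of _ _ "\<lambda>s. (f j s)\<^sup>2"] f_cont
      unfolding set_integrable_def by (metis continuous_on_power)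
  qed simp
  also have "\<dots> > 0"
  proof (rule prod_pos)
    fix j
    have "f j (vec_nth (corner M) j + edge M * (real (t j) + 1)) = 1"
    proof -
      have "(vec_nth (corner M) j + edge M * (real (t j) + 1)
          - (vec_nth (corner M) j + edge M * (real (t j) + 1/2))) / (edge M / 2) = 1"
        using edge_pos by (simp add: field_simps)
      then show ?thesis by (simp add: f_def legendre_at_ends)
    qed
    then show "0 < (LINT s|lborel. indicator (?I j) s *\<^sub>R (f j s)\<^sup>2)"
      using edge_pos by (intro set_integral_square_pos[unfolded set_lebesgue_integral_def] f_cont) auto
  qed
  finally show ?thesis .
qed

text \<open>The cell on the other side, if there is one, contributes trace zero. Squaring removes
  the sign, which differs between interior and boundary faces.\<close>

lemma face_jump_basis_fun_square:
  assumes t: "t \<in> cells M" and x: "x \<in> face_set M (i, t)"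
  shows "(face_jump M (i, t) (basis_fun M (t, \<sigma>)) x)\<^sup>2 = (cell_poly M (t, \<sigma>) x)\<^sup>2"
proof -
  obtain P' where P: "C1_fun (cell_poly M (t, \<sigma>)) P'" using C1_fun_cell_poly[OF edge_pos] by blast
  have upper: "cell_trace M t (basis_fun M (t, \<sigma>)) x = cell_poly M (t, \<sigma>) x"
    by (rule cell_trace_eq[OF edge_pos subsetD[OF face_set_subset_cell x] C1_fun_continuous[OF P]])
       (use interior_subset in \<open>fastforce simp: basis_fun_def cell_poly_def\<close>)
  have lower: "cell_trace M (t(i := t i - 1)) (basis_fun M (t, \<sigma>)) x = 0" if "0 < t i"
  proof (rule cell_trace_eq[OF edge_pos subsetD[OF face_set_subset_lower_cell x]])
    have "t(i := t i - 1) \<noteq> t" using that by (auto simp: fun_eq_iff)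
    then show "basis_fun M (t, \<sigma>) y = 0" if "y \<in> interior (cell M (t(i := t i - 1)))" for y
      using interior_cell_disjoint[OF edge_pos _ that, of t] by (simp add: basis_fun_def)
  qed (use that in auto)
  have "t i \<noteq> extent M i" using t by (auto simp: cells_def dest: spec[of _ i])
  then show ?thesis using upper lower by (simp add: face_jump_def)
qed

text \<open>The gradient term gives nothing for constant basis functions, so positivity comes from
  the jump, on one lower face of the cell in an arbitrary direction.\<close>

lemma dg_norm_basis_fun_pos:
  assumes t: "t \<in> cells M" and k: "0 < k"
  shows "0 < dg_norm M k (basis_fun M (t, \<sigma>))"
proof -
  let ?u = "basis_fun M (t, \<sigma>)"
  obtain i :: 'd where True by blast
  have F: "(i, t) \<in> faces M" using t by (auto simp: faces_def cells_def intro: less_imp_le)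
  have nonneg: "0 \<le> face_integral M F (\<lambda>x. (face_jump M F ?u x)\<^sup>2)" for F
    unfolding face_integral_def set_lebesgue_integral_def
    by (rule Bochner_Integration.integral_nonneg) simp
  have "face_integral M (i, t) (\<lambda>x. (face_jump M (i, t) ?u x)\<^sup>2)
      = face_integral M (i, t) (\<lambda>x. (cell_poly M (t, \<sigma>) x)\<^sup>2)"
    by (rule face_integral_cong) (rule face_jump_basis_fun_square[OF t])
  then have "0 < (\<Sum>F\<in>faces M. face_integral M F (\<lambda>x. (face_jump M F ?u x)\<^sup>2))"
    using face_integral_cell_poly_square_pos[of i t \<sigma>] F nonneg finite_faces
    by (intro sum_pos2[of _ "(i, t)"]) auto
  then have "0 < (real k)\<^sup>2 / edge M * (\<Sum>F\<in>faces M. face_integral M F (\<lambda>x. (face_jump M F ?u x)\<^sup>2))"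
    using edge_pos k by simp
  moreover have "0 \<le> (\<Sum>t\<in>cells M. integral (cell M t) (\<lambda>x. (norm (grad ?u x))\<^sup>2))"
  proof (rule sum_nonneg)
    \<comment> \<open>If the integrand fails to be integrable, the integral is 0 by convention,
      which is nonnegative too.\<close>
    fix s
    show "0 \<le> integral (cell M s) (\<lambda>x. (norm (grad ?u x))\<^sup>2)"
      by (cases "(\<lambda>x. (norm (grad ?u x))\<^sup>2) integrable_on cell M s")
         (auto intro: integral_nonneg simp: not_integrable_integral)
  qed
  ultimately show ?thesis unfolding dg_norm_def by (subst real_sqrt_gt_0_iff) linarith
qed

section \<open>Passage from the form to the matrix\<close>

lemma sip_form_fun_of_vec:
  "sip_form \<alpha> M k (fun_of_vec M k e v) (fun_of_vec M k e w) =
    (\<Sum>r<ndofs M k. v $ r * (\<Sum>s<ndofs M k.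
       sip_form \<alpha> M k (basis_fun M (e r)) (basis_fun M (e s)) * w $ s))"
proof -
  have basis: "broken_C1 M (basis_fun M b)" for b using edge_pos by (rule broken_C1_basis_fun)
  have vec: "broken_C1 M (fun_of_vec M k e v)" for v
    unfolding fun_of_vec_def by (rule broken_C1_sum) (auto intro: basis)
  have left: "sip_form \<alpha> M k (fun_of_vec M k e v) z = (\<Sum>r<ndofs M k. v $ r * sip_form \<alpha> M k (basis_fun M (e r)) z)"
    if "broken_C1 M z" for v z
    unfolding fun_of_vec_def by (rule sip_form_sum_left) (auto intro: basis that)
  have "sip_form \<alpha> M k (basis_fun M (e r)) (fun_of_vec M k e w)
      = (\<Sum>s<ndofs M k. sip_form \<alpha> M k (basis_fun M (e r)) (basis_fun M (e s)) * w $ s)" for r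
    unfolding sip_form_commute[of \<alpha> k "basis_fun M (e r)"] left[OF basis] by (simp add: mult.commute)
  then show ?thesis by (simp add: left[OF vec])
qed

text \<open>Existence is witnessed by the matrix of the form in the basis; uniqueness holds because
  unit vectors read off every entry.\<close>

lemma sip_matrix:
  shows "sip_matrix \<alpha> M k e \<in> carrier_mat (ndofs M k) (ndofs M k)"
    and "v \<in> carrier_vec (ndofs M k) \<Longrightarrow> w \<in> carrier_vec (ndofs M k) \<Longrightarrow>
      v \<bullet> (sip_matrix \<alpha> M k e *\<^sub>v w) = sip_form \<alpha> M k (fun_of_vec M k e v) (fun_of_vec M k e w)"
proof -
  let ?n = "ndofs M k"
  let ?P = "\<lambda>A. A \<in> carrier_mat ?n ?n \<and> (\<forall>v\<in>carrier_vec ?n. \<forall>w\<in>carrier_vec ?n.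
    v \<bullet> (A *\<^sub>v w) = sip_form \<alpha> M k (fun_of_vec M k e v) (fun_of_vec M k e w))"
  define A where "A = Matrix.mat ?n ?n (\<lambda>(r, s). sip_form \<alpha> M k (basis_fun M (e r)) (basis_fun M (e s)))"
  have "?P A"
    by (auto simp: A_def sip_form_fun_of_vec scalar_prod_def atLeast0LessThan)
  moreover have "B = A" if "?P B" for B
  proof (rule eq_matI)
    fix r s assume "r < dim_row A" "s < dim_col A"
    then have "r < ?n" "s < ?n" by (auto simp: A_def)
    with \<open>?P A\<close> \<open>?P B\<close> show "B $$ (r, s) = A $$ (r, s)" by (simp only: mat_entry_eq_scalar_prod[where n = ?n] unit_vec_carrier)
  qed (use that in \<open>auto simp: A_def\<close>)
  ultimately have "?P (sip_matrix \<alpha> M k e)"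
    unfolding sip_matrix_def by (rule theI)
  then show "sip_matrix \<alpha> M k e \<in> carrier_mat ?n ?n"
    and "v \<in> carrier_vec ?n \<Longrightarrow> w \<in> carrier_vec ?n \<Longrightarrow>
      v \<bullet> (sip_matrix \<alpha> M k e *\<^sub>v w) = sip_form \<alpha> M k (fun_of_vec M k e v) (fun_of_vec M k e w)"
    by blast+
qed

text \<open>Coercivity is assumed for functions, so the sum over indices is turned into one over the
  basis by inverting the numbering.\<close>

lemma fun_of_vec_in_dg_space:
  assumes "dof_numbering M k e"
  shows "fun_of_vec M k e v \<in> dg_space M k"
proof -
  have e: "bij_betw e {..<ndofs M k} (dofs M k)" using assms by (simp add: dof_numbering_def)
  have "fun_of_vec M k e v x
      = (\<Sum>b\<in>dofs M k. v $ inv_into {..<ndofs M k} e b * basis_fun M b x)" for x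
    unfolding fun_of_vec_def sum.reindex_bij_betw[OF e, symmetric]
    by (rule sum.cong) (use bij_betw_inv_into_left[OF e] in auto)
  then show ?thesis
    unfolding dg_space_def
    by (intro CollectI exI[of _ "\<lambda>b. v $ inv_into {..<ndofs M k} e b"] ext)
qed

lemma fun_of_vec_unit:
  assumes "r < ndofs M k"
  shows "fun_of_vec M k e (unit_vec (ndofs M k) r) = basis_fun M (e r)"
proof
  fix x
  have "fun_of_vec M k e (unit_vec (ndofs M k) r) x
      = (\<Sum>s<ndofs M k. if s = r then basis_fun M (e s) x else 0)"
    unfolding fun_of_vec_def by (rule sum.cong) (use assms in \<open>auto simp: unit_vec_def\<close>)
  then show "fun_of_vec M k e (unit_vec (ndofs M k) r) x = basis_fun M (e r) x"
    using assms by simp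
qed

text \<open>A spectral radius is a maximum over the spectrum, which is nonempty only in positive
  dimension. The constant polynomial on the corner cell witnesses that there is a basis
  function.\<close>

lemma ndofs_pos:
  assumes "dof_numbering M k e"
  shows "0 < ndofs M k"
proof -
  have "((\<lambda>_. 0), (\<lambda>_. 0)) \<in> dofs M k" using extent_pos by (simp add: dofs_def cells_def)
  then show ?thesis using assms by (auto simp: dof_numbering_def bij_betw_def)
qed

end

theorem lemma4p6:
  fixes \<Omega> :: "(real^'d::finite) set"
    and M :: "'d cart_mesh"
    and \<alpha>\<^sub>0 \<omega> :: real
    and p k m :: nat
    and e :: "nat \<Rightarrow> ('d \<Rightarrow> nat) \<times> ('d \<Rightarrow> nat)"
    and A :: "real Matrix.mat"
    and g :: "real Matrix.vec"
  assumes "uniform_mesh_of M \<Omega>"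
    and "\<alpha>\<^sub>0 > 0"
    and "uniformly_stable \<alpha>\<^sub>0 \<Omega> p"
    and "k \<in> {2..p}"
    and "m \<ge> 1"
    and "dof_numbering M k e"
    and "A = sip_matrix \<alpha>\<^sub>0 M k e"
    and "0 < \<omega> * real_spectral_radius (jacobi_matrix A)"
    and "\<omega> * real_spectral_radius (jacobi_matrix A) \<le> 1"
    and "g \<in> carrier_vec (ndofs M k)"
  shows "energy_norm A 1 (poly_at_mat (smoother_poly m) (\<omega> \<cdot>\<^sub>m jacobi_matrix A) *\<^sub>v g)
           \<le> energy_norm A 1 g"
proof -
  interpret cartesian_mesh M
    using assms(1) by unfold_locales (auto simp: uniform_mesh_of_def)
  let ?n = "ndofs M k"
  have k: "k \<in> {1..p}" "0 < k" using assms(4) by auto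
  obtain c where c: "0 < c"
    and coercive: "\<And>v. v \<in> dg_space M k \<Longrightarrow> c * (dg_norm M k v)\<^sup>2 \<le> sip_form \<alpha>\<^sub>0 M k v v"
    using assms(1,3) k(1) unfolding uniformly_stable_def by blast
  note A_carrier = sip_matrix(1)[of \<alpha>\<^sub>0 k e, folded assms(7)]
  note A_form = sip_matrix(2)[where \<alpha> = \<alpha>\<^sub>0 and k = k and e = e, folded assms(7)]
  \<comment> \<open>Coercivity is weakened here to nonnegativity; its strict part is used below for
    the diagonal.\<close>
  interpret psd_matrix ?n A
  proof
    show "x \<bullet> (A *\<^sub>v y) = y \<bullet> (A *\<^sub>v x)" if "x \<in> carrier_vec ?n" "y \<in> carrier_vec ?n" for x y
      unfolding A_form[OF that] A_form[OF that(2,1)] by (rule sip_form_commute)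
    show "0 \<le> x \<bullet> (A *\<^sub>v x)" if "x \<in> carrier_vec ?n" for x
      using coercive[OF fun_of_vec_in_dg_space[OF assms(6), of x]] c
      unfolding A_form[OF that that] by (meson order.trans mult_nonneg_nonneg less_imp_le zero_le_power2)
  qed (rule A_carrier)
  show ?thesis
  proof (rule smoother_contracts_energy_norm[OF ndofs_pos[OF assms(6)] _ assms(8,9,10)])
    fix r assume r: "r < ?n"
    have "e r \<in> dofs M k" using assms(6) r by (auto simp: dof_numbering_def bij_betw_def)
    then obtain t \<sigma> where er: "e r = (t, \<sigma>)" "t \<in> cells M" by (auto simp: dofs_def)
    \<comment> \<open>A diagonal entry is the energy of a basis function, which coercivity bounds
      below by a positive norm.\<close>
    have "A $$ (r, r) = unit_vec ?n r \<bullet> (A *\<^sub>v unit_vec ?n r)"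
      using A_carrier r by (intro mat_entry_eq_scalar_prod)
    also have "\<dots> = sip_form \<alpha>\<^sub>0 M k (basis_fun M (e r)) (basis_fun M (e r))"
      by (simp add: A_form fun_of_vec_unit[OF r])
    also have "\<dots> \<ge> c * (dg_norm M k (basis_fun M (e r)))\<^sup>2"
      using coercive[OF fun_of_vec_in_dg_space[OF assms(6), of "unit_vec ?n r"]]
      by (simp add: fun_of_vec_unit[OF r])
    moreover have "0 < c * (dg_norm M k (basis_fun M (e r)))\<^sup>2"
      using c dg_norm_basis_fun_pos[OF er(2) k(2), of \<sigma>] by (simp add: er)
    ultimately show "0 < A $$ (r, r)" by simp
  qed
qed

end
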